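(* Let $S\subseteq T\subseteq \mathbb{N}^*$ be trees, where $T$ is finitely branching and each node of $T$ has at least two successors in $T$, and $S$ has no leaves. Suppose that $S$ is level-wise uniformly branching. Then, viewing the set of paths $[S]$ as a subset of the metric space $([T],d)$, we have $$\dim_H [S] = \underline{\dim}_B [S] \qquad\text{and}\qquad \dim_P [S] = \overline{\dim}_B [S].$$
   Context: $\mathbb{N}^*$ is the set of finite tuples (strings) of natural numbers, viewed as a rooted tree in which the successors of a string $\sigma$ are the strings obtained from $\sigma$ by appending one element. A (sub)tree is a nonempty subset closed under initial segments. For a tree $T$, $T_n$ is the set of strings in $T$ of length $n$, and $[T]$ is the set of paths, i.e. infinite sequences $f$ whose initial segment $f\upharpoonright_n$ of length $n$ lies in $T_n$ for every $n$. A leaf is a node without successors in the tree. A tree $S$ is level-wise uniformly branching if for each $n$, all $\sigma\in S_n$ have the same number of successors in $S$. The metric on $[T]$: for distinct $f,g\in[T]$, $d(f,g)=1/|T_n|$ where $n$ is largest such that $f\upharpoonright_n=g\upharpoonright_n$; $d(f,f)=0$. Let $X$ be a bounded subset of a metric space $M$. Box dimensions: let $N_\alpha(X)$ be the least cardinality of a covering of $X$ by sets of diameter at most $\alpha$. Then $$\underline{\dim}_B(X)=\liminf_{\alpha\to0^+}\frac{\log N_\alpha(X)}{\log(1/\alpha)},\qquad \overline{\dim}_B(X)=\limsup_{\alpha\to0^+}\frac{\log N_\alpha(X)}{\log(1/\alpha)}.$$ Hausdorff dimension: for $r\ge0$, $H^r(X)=\lim_{\alpha\to0^+}\inf\sum_{i\in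 I}\operatorname{diam}(E_i)^r$, where the infimum is over all countable covers $(E_i)_{i\in I}$ of $X$ by sets of diameter at most $\alpha$, and $\dim_H(X)$ is the supremum of the $r$ such that $H^r(X)>0$. Packing dimension: for $r\ge0$, $$P^r(X)=\inf_{\mathcal U}\Big\{\sum_{U\in\mathcal U}\ \lim_{\alpha\to0^+}\Big(\sup\sum_{i\in I}\operatorname{diam}(E_i^U)^r\Big)\Big\},$$ where the infimum is over all countable coverings $\mathcal U$ of $X$, and the inner suprema are over all countable collections $(E_i^U)_{i\in I}$ of disjoint open balls with center in $U$ and diameter at most $\alpha$. Then $\dim_P(X)$ is the supremum of the $r$ such that $P^r(X)>0$.
   Formalization: In the packing measure, the diameter of a ball is taken to be twice its radius, not its diameter as a set of paths; with the latter the second equation fails, e.g. for S = T level-wise uniformly branching with |T_n| = 2^(2^n − 1), where dim_P ≤ 1 but the upper box dimension is 2. *)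

theory Defs
  imports "HOL-Analysis.Analysis" "HOL-Library.Sublist"
begin

section \<open>Dimensions of subsets of a metric space\<close>

text \<open>The logarithm of a cardinality, with the limit values at \<open>0\<close> and \<open>\<infinity>\<close>
  (for reals, the library has \<open>ln 0 = 0\<close>).\<close>

definition log_card :: "enat \<Rightarrow> ereal" where
  "log_card n = (case n of enat k \<Rightarrow> if k = 0 then - \<infinity> else ereal (ln (real k)) | \<infinity> \<Rightarrow> \<infinity>)"

context Metric_space
begin

definition mdiam :: "'a set \<Rightarrow> ennreal" where
  "mdiam E = (SUP (x, y) \<in> E \<times> E. ennreal (d x y))"

definition covering_number :: "real \<Rightarrow> 'a set \<Rightarrow> enat" where
  "covering_number \<alpha> X =
     (INF \<C> \<in> {\<C>. finite \<C> \<and> X \<subseteq> \<Union>\<C> \<and> (\<forall>E\<in>\<C>. E \<subseteq> M \<and> mdiam E \<le> ennreal \<alpha>)}. enat (card \<C>))"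

definition lower_box_dim :: "'a set \<Rightarrow> ereal" where
  "lower_box_dim X = Liminf (at_right 0) (\<lambda>\<alpha>. log_card (covering_number \<alpha> X) / ereal (ln (1 / \<alpha>)))"

definition upper_box_dim :: "'a set \<Rightarrow> ereal" where
  "upper_box_dim X = Limsup (at_right 0) (\<lambda>\<alpha>. log_card (covering_number \<alpha> X) / ereal (ln (1 / \<alpha>)))"

text \<open>The convention is \<open>0\<^sup>0 = 1\<close>, whereas \<open>0 powr 0 = 0\<close>; this makes the measure for
  \<open>r = 0\<close> the counting measure.  Only sets of finite diameter are measured below.\<close>

definition diam_pow :: "real \<Rightarrow> 'a set \<Rightarrow> ennreal" where
  "diam_pow r E = (if r = 0 then 1 else ennreal (enn2real (mdiam E) powr r))"

text \<open>Countable families are indexed by subsets of \<open>\<nat>\<close>, so finite families are included.\<close>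

definition hausdorff_pre :: "real \<Rightarrow> real \<Rightarrow> 'a set \<Rightarrow> ennreal" where
  "hausdorff_pre r \<alpha> X =
     (INF (I, E) \<in> {(I :: nat set, E). X \<subseteq> (\<Union>i\<in>I. E i) \<and>
                       (\<forall>i\<in>I. E i \<subseteq> M \<and> mdiam (E i) \<le> ennreal \<alpha>)}.
        \<Sum>\<^sub>\<infinity>i\<in>I. diam_pow r (E i))"

definition hausdorff_meas :: "real \<Rightarrow> 'a set \<Rightarrow> ennreal" where
  "hausdorff_meas r X = Lim (at_right 0) (\<lambda>\<alpha>. hausdorff_pre r \<alpha> X)"

definition hausdorff_dim :: "'a set \<Rightarrow> ereal" where
  "hausdorff_dim X = Sup {ereal r | r. 0 \<le> r \<and> 0 < hausdorff_meas r X}"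

text \<open>A ball of a packing is given by its centre \<open>c i\<close> and its radius \<open>\<rho> i\<close>, and its diameter is
  \<open>2 * \<rho> i\<close>, as is usual for packing measures in general metric spaces.  In a path space, the same
  point set is a ball for a whole interval of radii, and its diameter \<open>mdiam\<close> as a point set can be
  much smaller than these radii.  With \<open>mdiam\<close> in place of \<open>2 * \<rho> i\<close>, packing and upper box dimension
  would differ for the whole path space of a level-wise uniformly branching tree with
  \<open>2 ^ (2 ^ n - 1)\<close> nodes on each level \<open>n\<close>: they would be \<open>1\<close> and \<open>2\<close>.\<close>

definition packing_pre :: "real \<Rightarrow> real \<Rightarrow> 'a set \<Rightarrow> ennreal" where
  "packing_pre r \<alpha> U =
     (SUP (I, c, \<rho>) \<in> {(I :: nat set, c, \<rho> :: nat \<Rightarrow> real).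
                         (\<forall>i\<in>I. c i \<in> U \<and> 0 < \<rho> i \<and> 2 * \<rho> i \<le> \<alpha>) \<and>
                         disjoint_family_on (\<lambda>i. mball (c i) (\<rho> i)) I}.
        \<Sum>\<^sub>\<infinity>i\<in>I. ennreal ((2 * \<rho> i) powr r))"

definition packing_meas :: "real \<Rightarrow> 'a set \<Rightarrow> ennreal" where
  "packing_meas r X =
     (INF \<U> \<in> {\<U>. countable \<U> \<and> (\<forall>U\<in>\<U>. U \<subseteq> M) \<and> X \<subseteq> \<Union>\<U>}.
        \<Sum>\<^sub>\<infinity>U\<in>\<U>. Lim (at_right 0) (\<lambda>\<alpha>. packing_pre r \<alpha> U))"

definition packing_dim :: "'a set \<Rightarrow> ereal" where
  "packing_dim X = Sup {ereal r | r. 0 \<le> r \<and> 0 < packing_meas r X}"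

end


section \<open>Trees of strings and their path spaces\<close>

definition is_tree :: "nat list set \<Rightarrow> bool" where
  "is_tree T \<longleftrightarrow> T \<noteq> {} \<and> (\<forall>\<sigma>\<in>T. \<forall>\<tau>. prefix \<tau> \<sigma> \<longrightarrow> \<tau> \<in> T)"

definition succs :: "nat list set \<Rightarrow> nat list \<Rightarrow> nat list set" where
  "succs T \<sigma> = {\<sigma> @ [k] | k. \<sigma> @ [k] \<in> T}"

definition level :: "nat list set \<Rightarrow> nat \<Rightarrow> nat list set" where
  "level T n = {\<sigma> \<in> T. length \<sigma> = n}"

definition finitely_branching :: "nat list set \<Rightarrow> bool" where
  "finitely_branching T \<longleftrightarrow> (\<forall>\<sigma>\<in>T. finite (succs T \<sigma>))"

definition is_leaf :: "nat list set \<Rightarrow> nat list \<Rightarrow> bool" where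
  "is_leaf T \<sigma> \<longleftrightarrow> \<sigma> \<in> T \<and> succs T \<sigma> = {}"

text \<open>Only meant for finitely branching trees, as \<open>card\<close> is \<open>0\<close> on infinite sets.\<close>

definition levelwise_uniformly_branching :: "nat list set \<Rightarrow> bool" where
  "levelwise_uniformly_branching S \<longleftrightarrow>
     (\<forall>n. \<forall>\<sigma>\<in>level S n. \<forall>\<tau>\<in>level S n. card (succs S \<sigma>) = card (succs S \<tau>))"

definition restr :: "(nat \<Rightarrow> nat) \<Rightarrow> nat \<Rightarrow> nat list" where
  "restr f n = map f [0..<n]"

definition paths :: "nat list set \<Rightarrow> (nat \<Rightarrow> nat) set" where
  "paths T = {f. \<forall>n. restr f n \<in> level T n}"

definition path_dist :: "nat list set \<Rightarrow> (nat \<Rightarrow> nat) \<Rightarrow> (nat \<Rightarrow> nat) \<Rightarrow> real" where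
  "path_dist T f g =
     (if f = g then 0 else 1 / real (card (level T (GREATEST n. restr f n = restr g n))))"

lemma restr_mono: "restr f n = restr g n \<Longrightarrow> m \<le> n \<Longrightarrow> restr f m = restr g m"
  by (auto simp: restr_def)

lemma restr_bounded:
  assumes "f \<noteq> g"
  obtains b where "\<And>n. restr f n = restr g n \<Longrightarrow> n \<le> b"
proof -
  from assms obtain k where k: "f k \<noteq> g k" by auto
  have "n \<le> k" if "restr f n = restr g n" for n
    using that k by (auto simp: restr_def intro: leI)
  then show ?thesis by (rule that)
qed

lemma level_Suc: "is_tree T \<Longrightarrow> level T (Suc n) = (\<Union>\<sigma>\<in>level T n. succs T \<sigma>)"
proof (intro equalityI subsetI)
  fix \<tau> assume T: "is_tree T" and "\<tau> \<in> level T (Suc n)"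
  then have t: "\<tau> \<in> T" "length \<tau> = Suc n" by (auto simp: level_def)
  then have eq: "\<tau> = butlast \<tau> @ [last \<tau>]" by (metis append_butlast_last_id list.size(3) nat.distinct(1))
  then have "butlast \<tau> \<in> T" using T t by (metis is_tree_def prefixI)
  then show "\<tau> \<in> (\<Union>\<sigma>\<in>level T n. succs T \<sigma>)"
    using t eq by (auto simp: level_def succs_def intro!: bexI[of _ "butlast \<tau>"] exI[of _ "last \<tau>"])
qed (auto simp: level_def succs_def)

lemma finite_level:
  assumes "is_tree T" "finitely_branching T"
  shows "finite (level T n)"
proof (induction n)
  case 0
  have "level T 0 \<subseteq> {[]}" by (auto simp: level_def)
  then show ?case by (rule finite_subset) simp
next
  case (Suc n)
  moreover have "finite (succs T \<sigma>)" if "\<sigma> \<in> level T n" for \<sigma>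
    using assms that by (simp add: finitely_branching_def level_def)
  ultimately show ?case unfolding level_Suc[OF assms(1)] by (rule finite_UN_I)
qed

lemma card_level_mono:
  assumes "is_tree T" "finitely_branching T" "\<forall>\<sigma>. \<not> is_leaf T \<sigma>" "m \<le> n"
  shows "card (level T m) \<le> card (level T n)"
  using assms(4)
proof (induction n rule: dec_induct)
  case (step n)
  have "\<exists>g. \<forall>\<sigma>\<in>level T n. g \<sigma> \<in> succs T \<sigma>"
    using assms(3) by (intro bchoice) (auto simp: is_leaf_def level_def)
  then obtain g where g: "\<And>\<sigma>. \<sigma> \<in> level T n \<Longrightarrow> g \<sigma> \<in> succs T \<sigma>" by blast
  have "inj_on g (level T n)"
    using g by (intro inj_on_inverseI[where g = butlast]) (fastforce simp: succs_def)
  moreover have "g ` level T n \<subseteq> level T (Suc n)"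
    using g assms(1) by (auto simp: level_Suc)
  ultimately have "card (level T n) \<le> card (level T (Suc n))"
    using finite_level[OF assms(1,2)] by (metis card_inj_on_le)
  then show ?case using step by simp
qed simp

lemma Metric_space_paths:
  assumes "is_tree T" "finitely_branching T" "\<forall>\<sigma>. \<not> is_leaf T \<sigma>"
  shows "Metric_space (paths T) (path_dist T)"
proof
  fix f g show "0 \<le> path_dist T f g" by (simp add: path_dist_def)
  show "path_dist T f g = path_dist T g f"
    by (auto simp: path_dist_def eq_commute)
next
  have pos: "0 < card (level T n)" if "f \<in> paths T" for f n
  proof -
    have "restr f n \<in> level T n" using that by (simp add: paths_def)
    then show ?thesis using finite_level[OF assms(1,2)] card_gt_0_iff by blast
  qed
  {
    fix f g assume "f \<in> paths T" "g \<in> paths T"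
    then show "path_dist T f g = 0 \<longleftrightarrow> f = g"
      using pos[of f] by (auto simp: path_dist_def)
  next
    fix f g h assume fgh: "f \<in> paths T" "g \<in> paths T" "h \<in> paths T"
    let ?G = "\<lambda>f g. GREATEST n. restr f n = restr g n"
    have G: "restr f (?G f g) = restr g (?G f g)" "restr f n = restr g n \<Longrightarrow> n \<le> ?G f g"
      if "f \<noteq> g" for f g n
    proof -
      obtain b where b: "\<And>n. restr f n = restr g n \<Longrightarrow> n \<le> b"
        using restr_bounded[OF \<open>f \<noteq> g\<close>] by blast
      show "restr f (?G f g) = restr g (?G f g)"
        by (rule GreatestI_nat[of _ 0]) (use b in \<open>auto simp: restr_def\<close>)
      show "n \<le> ?G f g" if "restr f n = restr g n"
        using that b by (rule Greatest_le_nat)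
    qed
    show "path_dist T f h \<le> path_dist T f g + path_dist T g h"
    proof (cases "f = g \<or> g = h \<or> f = h")
      case True
      then show ?thesis by (auto simp: path_dist_def)
    next
      case False
      have min: "min (?G f g) (?G g h) \<le> ?G f h"
        by (rule G(2)) (use False in \<open>auto intro: trans[OF restr_mono[OF G(1)] restr_mono[OF G(1)]]\<close>)
      have le: "1 / real (card (level T n)) \<le> 1 / real (card (level T m))" if "m \<le> n" for m n
        using card_level_mono[OF assms that] pos[OF fgh(1)] by (intro divide_left_mono) auto
      have "path_dist T f h \<le> max (path_dist T f g) (path_dist T g h)"
        using False min by (auto simp: path_dist_def le_max_iff_disj min_le_iff_disj intro: le)
      also have "\<dots> \<le> path_dist T f g + path_dist T g h"
        by (auto simp: path_dist_def)
      finally show ?thesis .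
    qed
  }
qed

end

theory Submission
  imports Defs
begin

text \<open>Write \<open>t n\<close> and \<open>s n\<close> for the number of nodes of \<open>T\<close> and of \<open>S\<close> on level \<open>n\<close>.
  Hausdorff dimension is at most lower box dimension, and packing dimension at most upper box
  dimension, in every metric space.  For the converses, \<open>[S]\<close> is covered by \<open>s n\<close> sets of diameter
  at most \<open>1 / t n\<close>.  If \<open>r\<close> is below the lower box dimension, then \<open>(t n) powr r \<le> s n\<close> for large
  \<open>n\<close>, and giving each node of \<open>S\<close> on level \<open>n\<close> the mass \<open>1 / s n\<close> shows that the Hausdorff measure
  is at least \<open>1\<close>.  If \<open>r\<close> is below the upper box dimension, then \<open>(t n) powr r < s (Suc n)\<close> for
  infinitely many \<open>n\<close>.  By Baire category, some member \<open>U\<close> of any countable cover is dense in \<open>S\<close>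
  below some node; balls of radius \<open>1 / t n\<close> are cylinders of level \<open>Suc n\<close>, so \<open>U\<close> contains the
  centres of a fixed proportion of \<open>s (Suc n)\<close> disjoint balls of diameter \<open>2 / t n\<close>, and its
  packing premeasure is infinite.\<close>

section \<open>Limits at zero, infinite sums and logarithmic quotients\<close>

lemma tendsto_at_right_0_SUP:
  fixes f :: "real \<Rightarrow> 'a::{complete_linorder, linorder_topology}"
  assumes "\<And>x y. 0 < x \<Longrightarrow> x \<le> y \<Longrightarrow> f y \<le> f x"
  shows "(f \<longlongrightarrow> (SUP x\<in>{0<..}. f x)) (at_right 0)"
proof (rule order_tendstoI)
  fix a assume "a < (SUP x\<in>{0<..}. f x)"
  then obtain x where "0 < x" "a < f x" by (auto simp: less_SUP_iff)
  then show "eventually (\<lambda>x. a < f x) (at_right 0)"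
    unfolding eventually_at_right_field using assms by (meson less_le_trans less_imp_le)
next
  fix a assume a: "(SUP x\<in>{0<..}. f x) < a"
  have "f x < a" if "0 < x" for x
    using a that by (meson SUP_upper greaterThan_iff le_less_trans)
  then show "eventually (\<lambda>x. f x < a) (at_right 0)"
    unfolding eventually_at_right_field by (meson zero_less_one)
qed

lemma tendsto_at_right_0_INF:
  fixes f :: "real \<Rightarrow> 'a::{complete_linorder, linorder_topology}"
  assumes "\<And>x y. 0 < x \<Longrightarrow> x \<le> y \<Longrightarrow> f x \<le> f y"
  shows "(f \<longlongrightarrow> (INF x\<in>{0<..}. f x)) (at_right 0)"
proof (rule order_tendstoI)
  fix a assume "(INF x\<in>{0<..}. f x) < a"
  then obtain x where "0 < x" "f x < a" by (auto simp: INF_less_iff)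
  then show "eventually (\<lambda>x. f x < a) (at_right 0)"
    unfolding eventually_at_right_field using assms by (meson le_less_trans less_imp_le)
next
  fix a assume a: "a < (INF x\<in>{0<..}. f x)"
  have "a < f x" if "0 < x" for x
    using a that by (meson INF_lower greaterThan_iff less_le_trans)
  then show "eventually (\<lambda>x. a < f x) (at_right 0)"
    unfolding eventually_at_right_field by (meson zero_less_one)
qed

text \<open>Ensures that no \<open>infsum\<close> in the definitions falls back on its default value
  0.\<close>

lemma summable_on_ennreal [simp]: "(f :: 'a \<Rightarrow> ennreal) summable_on A"
  by (rule nonneg_summable_on_complete) simp

lemma infsum_mono_set_ennreal:
  fixes f :: "'a \<Rightarrow> ennreal"
  assumes "A \<subseteq> B"
  shows "infsum f A \<le> infsum f B"
  by (rule infsum_mono_neutral) (use assms in auto)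

lemma member_le_infsum_ennreal:
  fixes f :: "'a \<Rightarrow> ennreal"
  assumes "a \<in> A"
  shows "f a \<le> infsum f A"
  using infsum_mono_set_ennreal[of "{a}" A f] assms by simp

lemma eventually_powr_at_right_0_less:
  fixes s e :: real
  assumes "0 < s" "0 < e"
  shows "\<forall>\<^sub>F x in at_right 0. x powr s < e"
proof -
  have "x powr s < e" if "0 < x" "x < e powr (1/s)" for x
  proof -
    have "x powr s < (e powr (1/s)) powr s" using that assms by (intro powr_less_mono2) auto
    then show ?thesis using assms by (simp add: powr_powr)
  qed
  then show ?thesis unfolding eventually_at_right_field
    by (intro exI[of _ "e powr (1/s)"]) (use assms in auto)
qed

text \<open>Passes from logarithmic quotients to power bounds on covering numbers. The values 0 and
  \<infinity> of \<open>N\<close> are settled here once, by the limit values of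
  \<open>log_card\<close>.\<close>

lemma log_card_quotient_less_iff:
  assumes "0 < \<alpha>" "\<alpha> < 1"
  shows "log_card N / ereal (ln (1 / \<alpha>)) < ereal r \<longleftrightarrow> (\<exists>k. N = enat k \<and> real k < \<alpha> powr (-r))"
proof (cases N)
  case (enat k)
  have pos: "0 < ln (1 / \<alpha>)" using assms by simp
  show ?thesis
  proof (cases "k = 0")
    case True
    then show ?thesis using enat pos assms by (simp add: log_card_def)
  next
    case False
    have "log_card N / ereal (ln (1 / \<alpha>)) < ereal r \<longleftrightarrow> ln (real k) < r * ln (1 / \<alpha>)"
      using enat pos False by (simp add: log_card_def pos_divide_less_eq)
    also have "\<dots> \<longleftrightarrow> ln (real k) < ln (\<alpha> powr (-r))"
      using assms by (simp add: ln_div)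
    also have "\<dots> \<longleftrightarrow> real k < \<alpha> powr (-r)"
      using assms False by (subst ln_less_cancel_iff) auto
    finally show ?thesis using enat by simp
  qed
next
  case infinity
  then show ?thesis using assms by (simp add: log_card_def)
qed

lemma log_card_mono: "m \<le> n \<Longrightarrow> log_card m \<le> log_card n"
  by (cases m; cases n) (auto simp: log_card_def)

text \<open>Sorts the radii of a packing into dyadic classes. The lower bound is strict because
  counting the balls of one class needs radii above the scale of the cover.\<close>

lemma dyadic_scale:
  fixes \<rho> :: real
  assumes "0 < \<rho>" "\<rho> \<le> 1"
  obtains k :: nat where "(1/2) ^ Suc k < \<rho>" "\<rho> \<le> (1/2) ^ k"
proof -
  obtain m where m: "(1/2::real) ^ m < \<rho>" using real_arch_pow_inv[OF assms(1), of "1/2"] by auto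
  define n where "n = (LEAST m. (1/2::real) ^ m < \<rho>)"
  have n: "(1/2::real) ^ n < \<rho>" unfolding n_def by (rule LeastI[of _ m]) (rule m)
  with assms(2) have "n \<noteq> 0" by (metis linorder_not_less power_0)
  then obtain k where k: "n = Suc k" by (cases n) auto
  have "\<not> (1/2::real) ^ k < \<rho>" using k unfolding n_def by (intro not_less_Least) simp
  then show ?thesis using that n k by auto
qed

section \<open>Inequalities between the dimensions in an arbitrary metric space\<close>

context Metric_space
begin

lemma mdiam_ge: "x \<in> E \<Longrightarrow> y \<in> E \<Longrightarrow> ennreal (d x y) \<le> mdiam E"
  unfolding mdiam_def by (rule SUP_upper2[of "(x, y)"]) auto

lemma mdiam_le_iff:
  "0 \<le> \<alpha> \<Longrightarrow> mdiam E \<le> ennreal \<alpha> \<longleftrightarrow> (\<forall>x\<in>E. \<forall>y\<in>E. d x y \<le> \<alpha>)"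
  unfolding mdiam_def by (auto simp: SUP_le_iff)

lemma diam_pow_le:
  assumes "mdiam E \<le> ennreal \<alpha>" "0 < \<alpha>" "0 \<le> r"
  shows "diam_pow r E \<le> ennreal (\<alpha> powr r)"
proof (cases "r = 0")
  case False
  have "enn2real (mdiam E) \<le> \<alpha>" using assms by (simp add: enn2real_leI)
  then have "enn2real (mdiam E) powr r \<le> \<alpha> powr r"
    using assms by (intro powr_mono2) auto
  then show ?thesis using False by (simp add: diam_pow_def ennreal_leI)
qed (use assms in \<open>simp add: diam_pow_def\<close>)

lemma diam_pow_ge:
  assumes "x \<in> E" "y \<in> E" "mdiam E \<le> ennreal \<alpha>" "0 < d x y" "0 \<le> r"
  shows "ennreal (d x y powr r) \<le> diam_pow r E"
proof (cases "r = 0")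
  case False
  \<comment> \<open>Finiteness keeps \<open>enn2real\<close> from sending the diameter to 0.\<close>
  have "mdiam E < top" using assms(3) by (meson ennreal_less_top le_less_trans)
  then have "d x y \<le> enn2real (mdiam E)"
    using mdiam_ge[OF assms(1,2)] by (metis enn2real_ennreal enn2real_mono nonneg)
  then have "d x y powr r \<le> enn2real (mdiam E) powr r"
    using assms by (intro powr_mono2) auto
  then show ?thesis using False by (simp add: diam_pow_def ennreal_leI)
qed (use assms in \<open>simp add: diam_pow_def\<close>)

text \<open>The infimum of a nonempty set in \<open>enat\<close> is a member of it, and that of the
  empty set is \<infinity>, so a finite value comes from an actual cover.\<close>

lemma covering_number_attained:
  assumes "covering_number \<alpha> X = enat k"
  obtains \<C> where "finite \<C>" "card \<C> = k" "X \<subseteq> \<Union>\<C>" "\<And>E. E \<in> \<C> \<Longrightarrow> E \<subseteq> M \<and> mdiam E \<le> ennreal \<alpha>"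
proof -
  define A where "A = (\<lambda>\<C>. enat (card \<C>)) ` {\<C>. finite \<C> \<and> X \<subseteq> \<Union>\<C> \<and> (\<forall>E\<in>\<C>. E \<subseteq> M \<and> mdiam E \<le> ennreal \<alpha>)}"
  have "Inf A = enat k" using assms by (simp add: covering_number_def A_def)
  then have "A \<noteq> {}" and k: "(LEAST n. n \<in> A) = enat k"
    by (auto simp: Inf_enat_def split: if_splits)
  then obtain x where "x \<in> A" by blast
  then have "enat k \<in> A" unfolding k[symmetric] by (rule LeastI)
  then show ?thesis using that by (auto simp: A_def)
qed

lemma covering_number_le:
  assumes "finite \<C>" "X \<subseteq> \<Union>\<C>" "\<And>E. E \<in> \<C> \<Longrightarrow> E \<subseteq> M \<and> mdiam E \<le> ennreal \<alpha>"
  shows "covering_number \<alpha> X \<le> enat (card \<C>)"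
  unfolding covering_number_def using assms by (intro INF_lower) auto

lemma hausdorff_pre_antimono:
  assumes "\<alpha> \<le> \<beta>"
  shows "hausdorff_pre r \<beta> X \<le> hausdorff_pre r \<alpha> X"
proof -
  have "ennreal \<alpha> \<le> ennreal \<beta>" using assms by (rule ennreal_leI)
  then show ?thesis
    unfolding hausdorff_pre_def by (intro INF_superset_mono) (auto intro: order_trans)
qed

text \<open>A smaller \<alpha> admits fewer covers, so the premeasure increases as \<alpha>
  decreases. Hence the limit exists and \<open>Lim\<close> has its intended value.\<close>

lemma hausdorff_meas_eq_SUP: "hausdorff_meas r X = (SUP \<alpha>\<in>{0<..}. hausdorff_pre r \<alpha> X)"
  unfolding hausdorff_meas_def
  by (intro tendsto_Lim tendsto_at_right_0_SUP hausdorff_pre_antimono) auto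

lemma tendsto_packing_pre:
  "((\<lambda>\<alpha>. packing_pre r \<alpha> U) \<longlongrightarrow> (INF \<alpha>\<in>{0<..}. packing_pre r \<alpha> U)) (at_right 0)"
proof (rule tendsto_at_right_0_INF)
  fix \<alpha> \<beta> :: real assume "\<alpha> \<le> \<beta>"
  then show "packing_pre r \<alpha> U \<le> packing_pre r \<beta> U"
    unfolding packing_pre_def by (intro SUP_subset_mono) (auto intro: order_trans)
qed

lemma hausdorff_pre_le_covering_number:
  assumes "covering_number \<alpha> X = enat k" "0 < \<alpha>" "0 \<le> r"
  shows "hausdorff_pre r \<alpha> X \<le> ennreal (real k * \<alpha> powr r)"
proof -
  obtain \<C> where C: "finite \<C>" "card \<C> = k" "X \<subseteq> \<Union>\<C>"
      "\<And>E. E \<in> \<C> \<Longrightarrow> E \<subseteq> M \<and> mdiam E \<le> ennreal \<alpha>"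
    using covering_number_attained[OF assms(1)] by blast
  obtain e where e: "bij_betw e {0..<k} \<C>"
    using ex_bij_betw_nat_finite[OF C(1)] C(2) by auto
  have eC: "e ` {0..<k} = \<C>" using e by (simp add: bij_betw_def)
  have "hausdorff_pre r \<alpha> X \<le> (\<Sum>\<^sub>\<infinity>i\<in>{0..<k}. diam_pow r (e i))"
    unfolding hausdorff_pre_def
    by (rule INF_lower2[of "({0..<k}, e)"]) (use C eC in auto)
  also have "\<dots> = (\<Sum>i\<in>{0..<k}. diam_pow r (e i))" by simp
  also have "\<dots> \<le> (\<Sum>i\<in>{0..<k}. ennreal (\<alpha> powr r))"
    using C(4) eC assms by (intro sum_mono diam_pow_le) auto
  also have "\<dots> = ennreal (real k * \<alpha> powr r)"
    by (simp add: ennreal_mult ennreal_of_nat_eq_real_of_nat)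
  finally show ?thesis .
qed

text \<open>Let r' lie between the lower box dimension and r. At arbitrarily small \<alpha> fewer
  than \<open>\<alpha> powr (- r')\<close> sets cover X, and their total weight is at most
  \<open>\<alpha> powr (r - r')\<close>, which tends to 0.\<close>

lemma hausdorff_dim_le_lower_box_dim: "hausdorff_dim X \<le> lower_box_dim X"
  unfolding hausdorff_dim_def
proof (rule Sup_least, clarify)
  fix r :: real assume r: "0 \<le> r" "0 < hausdorff_meas r X"
  show "ereal r \<le> lower_box_dim X"
  proof (rule ccontr)
    assume "\<not> ereal r \<le> lower_box_dim X"
    then obtain r' where r': "lower_box_dim X < ereal r'" "r' < r"
      using ereal_dense2[of "lower_box_dim X" "ereal r"] by (auto simp: not_le)
    define Q where "Q \<alpha> = log_card (covering_number \<alpha> X) / ereal (ln (1 / \<alpha>))" for \<alpha>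
    have "\<not> (\<forall>\<^sub>F \<alpha> in at_right 0. ereal r' \<le> Q \<alpha>)"
      using Liminf_bounded[of "ereal r'" Q "at_right 0"] r'(1)
      by (auto simp: lower_box_dim_def Q_def[abs_def])
    then have freq: "\<exists>\<^sub>F \<alpha> in at_right 0. Q \<alpha> < ereal r'"
      by (simp add: frequently_def not_less)
    \<comment> \<open>The summand 0 fits the form of \<open>ennreal_le_epsilon\<close>. The good
      scales \<alpha> occur only frequently, so one below \<alpha>0 is picked and the bound is
      carried back by monotonicity.\<close>
    have "hausdorff_pre r \<alpha>0 X \<le> 0 + ennreal e" if "0 < \<alpha>0" "0 < e" for \<alpha>0 e
    proof -
      have "\<forall>\<^sub>F \<alpha> in at_right 0. \<alpha> powr (r - r') < e \<and> 0 < \<alpha> \<and> \<alpha> < min 1 \<alpha>0"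
        using that r' eventually_at_right_real[of 0 "min 1 \<alpha>0"]
        by (intro eventually_conj eventually_powr_at_right_0_less) (auto elim!: eventually_mono)
      then obtain \<alpha> where a: "Q \<alpha> < ereal r'" "\<alpha> powr (r - r') < e" "0 < \<alpha>" "\<alpha> < 1" "\<alpha> < \<alpha>0"
        using frequently_ex[OF frequently_eventually_conj[OF freq]] by force
      then obtain k where k: "covering_number \<alpha> X = enat k" "real k < \<alpha> powr (- r')"
        unfolding Q_def by (auto simp: log_card_quotient_less_iff)
      have "hausdorff_pre r \<alpha>0 X \<le> hausdorff_pre r \<alpha> X"
        using a(5) by (intro hausdorff_pre_antimono) simp
      also have "\<dots> \<le> ennreal (real k * \<alpha> powr r)"
        by (rule hausdorff_pre_le_covering_number[OF k(1) a(3) r(1)])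
      also have "\<dots> \<le> ennreal (\<alpha> powr (- r') * \<alpha> powr r)"
        using k(2) by (intro ennreal_leI mult_right_mono) auto
      also have "\<dots> \<le> ennreal e"
        using a by (intro ennreal_leI) (simp add: powr_add[symmetric])
      finally show ?thesis by simp
    qed
    then have "hausdorff_pre r \<alpha> X \<le> 0" if "0 < \<alpha>" for \<alpha>
      by (rule ennreal_le_epsilon) (use that in blast)
    then have "hausdorff_meas r X \<le> 0"
      unfolding hausdorff_meas_eq_SUP by (intro SUP_least) auto
    with r show False by simp
  qed
qed

text \<open>Two centres in the same set of the cover are at distance at most \<beta>, so one of them
  lies in both balls. Hence disjoint balls use different sets of the cover.\<close>

lemma packing_card_le_covering_number:
  assumes "covering_number \<beta> X = enat k" "0 < \<beta>" "X \<subseteq> M" "finite F"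
    and "\<And>i. i \<in> F \<Longrightarrow> c i \<in> X \<and> \<beta> < \<rho> i"
    and "disjoint_family_on (\<lambda>i. mball (c i) (\<rho> i)) F"
  shows "card F \<le> k"
proof -
  obtain \<C> where C: "finite \<C>" "card \<C> = k" "X \<subseteq> \<Union>\<C>"
      "\<And>E. E \<in> \<C> \<Longrightarrow> E \<subseteq> M \<and> mdiam E \<le> ennreal \<beta>"
    using covering_number_attained[OF assms(1)] by blast
  have "\<forall>i\<in>F. \<exists>E\<in>\<C>. c i \<in> E" using C(3) assms(5) by blast
  then obtain g where g: "\<And>i. i \<in> F \<Longrightarrow> g i \<in> \<C> \<and> c i \<in> g i" by metis
  have "inj_on g F"
  proof (rule inj_onI, rule ccontr)
    fix i j assume ij: "i \<in> F" "j \<in> F" "g i = g j" "i \<noteq> j"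
    have "d (c i) (c j) \<le> \<beta>"
      using g[OF ij(1)] g[OF ij(2)] ij(3) C(4)[of "g i"] assms(2) by (auto simp: mdiam_le_iff)
    then have "c j \<in> mball (c i) (\<rho> i)" "c j \<in> mball (c j) (\<rho> j)"
      using assms(2,3) assms(5)[OF ij(1)] assms(5)[OF ij(2)] by auto
    then show False using assms(6) ij unfolding disjoint_family_on_def by blast
  qed
  then show ?thesis using g C by (metis card_inj_on_le image_subsetI)
qed

text \<open>Let r' lie between the upper box dimension and r. Balls with radii between
  \<open>(1/2) ^ Suc k\<close> and \<open>(1/2) ^ k\<close> are at most as many as the covering
  number at the lower end, so for large k this class contributes at most a constant times the k-th
  power of some q < 1. Small \<alpha> leave only a tail of this geometric series, so the cover by X
  alone has weight 0.\<close>

lemma packing_dim_le_upper_box_dim: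
  assumes "X \<subseteq> M"
  shows "packing_dim X \<le> upper_box_dim X"
  unfolding packing_dim_def
proof (rule Sup_least, clarify)
  fix r :: real assume r: "0 \<le> r" "0 < packing_meas r X"
  show "ereal r \<le> upper_box_dim X"
  proof (rule ccontr)
    assume "\<not> ereal r \<le> upper_box_dim X"
    then obtain r' where r': "upper_box_dim X < ereal r'" "r' < r"
      using ereal_dense2[of "upper_box_dim X" "ereal r"] by (auto simp: not_le)
    have "\<forall>\<^sub>F \<alpha> in at_right 0. log_card (covering_number \<alpha> X) / ereal (ln (1 / \<alpha>)) < ereal r'"
      using r'(1) unfolding upper_box_dim_def by (rule Limsup_lessD)
    then obtain \<delta> where \<delta>: "0 < \<delta>"
        "\<And>\<alpha>. 0 < \<alpha> \<Longrightarrow> \<alpha> < \<delta> \<Longrightarrow> log_card (covering_number \<alpha> X) / ereal (ln (1 / \<alpha>)) < ereal r'"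
      unfolding eventually_at_right_field by auto
    \<comment> \<open>The product of the bound on the number of balls in class k and the bound on
      the weight of each splits into \<open>q ^ k\<close> and the factor \<open>C\<close>
      independent of k.\<close>
    define q :: real where "q = (1/2) powr (r - r')"
    define C :: real where "C = (1/2) powr (- r' - r)"
    have q: "0 < q" "q < 1" using r' by (auto simp: q_def powr01_less_one)
    have Cq: "((1/2) ^ Suc k) powr (- r') * (2 * (1/2) ^ k) powr r = C * q ^ k" for k
    proof -
      have "((1/2::real) ^ Suc k) powr (- r') = (1/2) powr (- r' * real (Suc k))"
        by (simp add: powr_realpow[symmetric] powr_powr mult.commute del: power_Suc)
      moreover have "(2 * (1/2::real) ^ k) = (1/2) powr (real k - 1)"
        by (simp add: powr_diff powr_realpow)
      moreover have "q ^ k = (1/2) powr ((r - r') * real k)"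
        using q by (simp add: q_def powr_realpow[symmetric] powr_powr)
      ultimately show ?thesis
        by (simp add: C_def powr_powr powr_add[symmetric] algebra_simps)
    qed
    have small: "\<forall>\<^sub>F \<alpha> in at_right 0. packing_pre r \<alpha> X \<le> ennreal e" if "0 < e" for e
    proof -
      have "summable (\<lambda>k. C * q ^ k)" using q by (intro summable_mult summable_geometric) auto
      then obtain K0 where K0: "\<And>m n. K0 \<le> m \<Longrightarrow> norm (\<Sum>k=m..<n. C * q ^ k) < e"
        using \<open>0 < e\<close> unfolding summable_Cauchy by blast
      obtain K1 where K1: "(1/2::real) ^ K1 < min \<delta> 1"
        using real_arch_pow_inv[of "min \<delta> 1" "1/2"] \<delta>(1) by auto
      \<comment> \<open>From \<open>K0\<close> on, the tails of the series are below e; from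
        \<open>K1\<close> on, the scales are below \<delta>, where the bound on the covering number
        holds.\<close>
      define K where "K = max K0 K1"
      have K: "(1/2::real) ^ Suc k < \<delta>" if "K \<le> k" for k
      proof -
        have "(1/2::real) ^ Suc k \<le> (1/2) ^ K1"
          using that by (intro power_decreasing) (auto simp: K_def)
        then show ?thesis using K1 by simp
      qed
      have "packing_pre r \<alpha> X \<le> ennreal e" if \<alpha>: "0 < \<alpha>" "\<alpha> < (1/2) ^ K" for \<alpha>
        unfolding packing_pre_def
      proof (rule SUP_least, clarify, rule infsum_le_finite_sums, rule summable_on_ennreal)
        fix I :: "nat set" and c \<rho> F
        assume I: "\<forall>i\<in>I. c i \<in> X \<and> 0 < \<rho> i \<and> 2 * \<rho> i \<le> \<alpha>"
          and disj: "disjoint_family_on (\<lambda>i. mball (c i) (\<rho> i)) I"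
          and F: "finite F" "F \<subseteq> I"
        have "\<exists>k. (1/2) ^ Suc k < \<rho> i \<and> \<rho> i \<le> (1/2) ^ k" if "i \<in> F" for i
        proof -
          have "0 < \<rho> i" "2 * \<rho> i \<le> \<alpha>" "(1/2::real) ^ K \<le> 1"
            using I F that by (auto intro: power_le_one)
          then have "0 < \<rho> i" "\<rho> i \<le> 1" using \<alpha> by linarith+
          then show ?thesis using dyadic_scale by metis
        qed
        then obtain h where h: "\<And>i. i \<in> F \<Longrightarrow> (1/2) ^ Suc (h i) < \<rho> i \<and> \<rho> i \<le> (1/2) ^ h i"
          by metis
        have hK: "K \<le> h i" if "i \<in> F" for i
        proof (rule ccontr)
          assume "\<not> K \<le> h i"
          then have "(1/2::real) ^ K \<le> (1/2) ^ Suc (h i)" by (intro power_decreasing) auto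
          then show False using h[OF that] I F that \<alpha> by force
        qed
        have fibre: "(\<Sum>i\<in>{i\<in>F. h i = k}. (2 * \<rho> i) powr r) \<le> C * q ^ k" if k: "k \<in> h ` F" for k
        proof -
          have "K \<le> k" using k hK by auto
          moreover have "(1/2::real) ^ Suc k < 1" by (rule power_Suc_less_one) auto
          ultimately obtain N where N: "covering_number ((1/2) ^ Suc k) X = enat N"
              "real N < ((1/2) ^ Suc k) powr (- r')"
            using log_card_quotient_less_iff[THEN iffD1, OF _ _ \<delta>(2)[OF _ K[OF \<open>K \<le> k\<close>]]]
            by (metis zero_less_power half_gt_zero zero_less_one)
          have "card {i\<in>F. h i = k} \<le> N"
          proof (rule packing_card_le_covering_number[OF N(1) _ assms])
            show "disjoint_family_on (\<lambda>i. mball (c i) (\<rho> i)) {i\<in>F. h i = k}"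
              by (rule disjoint_family_on_mono[OF _ disj]) (use F in auto)
          qed (use F I h in \<open>auto simp del: power_Suc\<close>)
          then have card: "real (card {i\<in>F. h i = k}) \<le> ((1/2) ^ Suc k) powr (- r')"
            using N(2) by linarith
          have "(\<Sum>i\<in>{i\<in>F. h i = k}. (2 * \<rho> i) powr r)
              \<le> (\<Sum>i\<in>{i\<in>F. h i = k}. (2 * (1/2) ^ k) powr r)"
            using h I F r by (intro sum_mono powr_mono2) (auto simp: less_imp_le)
          also have "\<dots> = real (card {i\<in>F. h i = k}) * (2 * (1/2) ^ k) powr r" by simp
          also have "\<dots> \<le> C * q ^ k"
            unfolding Cq[symmetric] by (rule mult_right_mono[OF card]) simp
          finally show ?thesis .
        qed
        obtain n where n: "h ` F \<subseteq> {..<n}" using F(1) finite_nat_bounded by blast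
        have "(\<Sum>i\<in>F. (2 * \<rho> i) powr r) = (\<Sum>k\<in>h ` F. \<Sum>i\<in>{i\<in>F. h i = k}. (2 * \<rho> i) powr r)"
          by (rule sum.image_gen[OF F(1)])
        also have "\<dots> \<le> (\<Sum>k\<in>h ` F. C * q ^ k)" by (rule sum_mono[OF fibre])
        also have "\<dots> \<le> (\<Sum>k=K..<n. C * q ^ k)"
          using n hK q by (intro sum_mono2) (auto simp: C_def)
        also have "\<dots> \<le> e" using K0[of K n] by (simp add: K_def)
        finally show "(\<Sum>i\<in>F. ennreal ((2 * \<rho> i) powr r)) \<le> ennreal e"
          by (simp add: sum_ennreal ennreal_leI)
      qed
      then show ?thesis unfolding eventually_at_right_field
        by (intro exI[of _ "(1/2) ^ K"]) auto
    qed
    have "(INF \<alpha>\<in>{0<..}. packing_pre r \<alpha> X) \<le> 0 + ennreal e" if "0 < e" for e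
      using tendsto_upperbound[OF tendsto_packing_pre small[OF that]] by simp
    then have "Lim (at_right 0) (\<lambda>\<alpha>. packing_pre r \<alpha> X) \<le> 0"
      using tendsto_Lim[OF _ tendsto_packing_pre, of r X] ennreal_le_epsilon[of 0]
      by (metis trivial_limit_at_right_real)
    moreover have "packing_meas r X \<le> (\<Sum>\<^sub>\<infinity>U\<in>{X}. Lim (at_right 0) (\<lambda>\<alpha>. packing_pre r \<alpha> U))"
      unfolding packing_meas_def by (rule INF_lower) (use assms in auto)
    ultimately show False using r by simp
  qed
qed

end

section \<open>Initial segments and chains of strings\<close>

lemma length_restr [simp]: "length (restr f n) = n"
  by (simp add: restr_def)

lemma restr_eq_list_iff: "restr f n = xs \<longleftrightarrow> length xs = n \<and> (\<forall>i<n. f i = xs ! i)"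
  by (auto simp: restr_def list_eq_iff_nth_eq)

lemma prefix_restr: "m \<le> n \<Longrightarrow> prefix (restr f m) (restr f n)"
  unfolding restr_def by (metis le_add_diff_inverse map_append prefixI upt_add_eq_append zero_le)

lemma card_succs_disjoint_UN:
  assumes "finite A" "\<And>\<sigma>. \<sigma> \<in> A \<Longrightarrow> finite (succs T \<sigma>)"
  shows "card (\<Union>\<sigma>\<in>A. succs T \<sigma>) = (\<Sum>\<sigma>\<in>A. card (succs T \<sigma>))"
  using assms by (intro card_UN_disjoint) (auto simp: succs_def)

lemma le_length_chain:
  assumes "\<And>k. strict_prefix (\<sigma> k) (\<sigma> (Suc k))"
  shows "n \<le> length (\<sigma> n)"
  by (induction n) (auto intro: le_less_trans prefix_length_less[OF assms] Suc_leI)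

lemma chain_limit:
  assumes "\<And>k. strict_prefix (\<sigma> k) (\<sigma> (Suc k))"
  obtains f where "\<And>k. restr f (length (\<sigma> k)) = \<sigma> k"
proof
  fix k
  have pre: "prefix (\<sigma> i) (\<sigma> j)" if "i \<le> j" for i j
    using that by (induction rule: dec_induct) (auto intro: prefix_order.trans prefix_order.less_imp_le assms)
  have nth: "\<sigma> i ! n = \<sigma> j ! n" if "n < length (\<sigma> i)" "n < length (\<sigma> j)" for i j n
    using that pre[of i j] pre[of j i] by (metis nat_le_linear nth_append prefix_def)
  \<comment> \<open>The string \<open>\<sigma> (Suc n)\<close> has length at least n + 1, so its
    entry n exists, and by \<open>nth\<close> it agrees with that of every other string long
    enough.\<close>
  show "restr (\<lambda>n. \<sigma> (Suc n) ! n) (length (\<sigma> k)) = \<sigma> k"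
    unfolding restr_eq_list_iff using nth le_length_chain[of \<sigma>, OF assms] by (metis Suc_le_eq)
qed

section \<open>Level sizes of the two trees and the metric on the path space\<close>

locale uniform_subtree =
  fixes S T :: "nat list set"
  assumes tree_S: "is_tree S" and tree_T: "is_tree T" and subtree: "S \<subseteq> T"
    and fin_T: "finitely_branching T"
    and two_le_card_succs: "\<And>\<sigma>. \<sigma> \<in> T \<Longrightarrow> 2 \<le> card (succs T \<sigma>)"
    and no_leaf_S: "\<And>\<sigma>. \<not> is_leaf S \<sigma>"
    and uniform_S: "levelwise_uniformly_branching S"
begin

abbreviation t :: "nat \<Rightarrow> nat" where "t n \<equiv> card (level T n)"
abbreviation s :: "nat \<Rightarrow> nat" where "s n \<equiv> card (level S n)"

text \<open>Cylinders are taken in the ambient space \<open>paths T\<close>, where covering sets and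
  balls live.\<close>

definition cyl :: "nat list \<Rightarrow> (nat \<Rightarrow> nat) set" where
  "cyl \<sigma> = {f \<in> paths T. restr f (length \<sigma>) = \<sigma>}"

definition extensions :: "nat list \<Rightarrow> nat \<Rightarrow> nat list set" where
  "extensions \<sigma> n = {\<tau> \<in> level S n. prefix \<sigma> \<tau>}"

lemma finite_level_T [simp]: "finite (level T n)"
  by (rule finite_level[OF tree_T fin_T])

lemma level_S_subset: "level S n \<subseteq> level T n"
  using subtree by (auto simp: level_def)

lemma finite_level_S [simp]: "finite (level S n)"
  by (rule finite_subset[OF level_S_subset]) simp

lemma finite_extensions [simp]: "finite (extensions \<sigma> n)"
  unfolding extensions_def by simp

lemma finite_succs: "\<sigma> \<in> T \<Longrightarrow> finite (succs T \<sigma>)"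
  using fin_T by (simp add: finitely_branching_def)

lemma finite_succs_S: "\<sigma> \<in> S \<Longrightarrow> finite (succs S \<sigma>)"
  using subtree by (intro finite_subset[OF _ finite_succs[of \<sigma>]]) (auto simp: succs_def)

lemma Nil_in_S: "[] \<in> S" and Nil_in_T: "[] \<in> T"
  using tree_S tree_T by (auto simp: is_tree_def)

lemma level_S_0: "level S 0 = {[]}" and level_T_0: "level T 0 = {[]}"
  using Nil_in_S Nil_in_T by (auto simp: level_def)

lemma t_Suc: "2 * t n \<le> t (Suc n)"
proof -
  have "t (Suc n) = (\<Sum>\<sigma>\<in>level T n. card (succs T \<sigma>))"
    unfolding level_Suc[OF tree_T] by (rule card_succs_disjoint_UN) (simp, simp add: level_def finite_succs)
  moreover have "(\<Sum>\<sigma>\<in>level T n. 2) \<le> (\<Sum>\<sigma>\<in>level T n. card (succs T \<sigma>))"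
    by (rule sum_mono) (simp add: level_def two_le_card_succs)
  ultimately show ?thesis by simp
qed

lemma power_le_t: "2 ^ n \<le> t n"
proof (induction n)
  case (Suc n)
  then show ?case using t_Suc[of n] by simp
qed (simp add: level_T_0)

lemma t_pos: "0 < t n"
  using power_le_t[of n] by (meson less_le_trans zero_less_numeral zero_less_power)

lemma level_T_nonempty [simp]: "level T n \<noteq> {}"
  using t_pos[of n] by auto

text \<open>Nonzero distances have the form \<open>1 / t n\<close>; strict growth allows the level
  at which two paths separate to be read off from their distance.\<close>

lemma strict_mono_t: "strict_mono t"
proof (rule strict_monoI_Suc)
  show "t n < t (Suc n)" for n using t_Suc[of n] t_pos[of n] by linarith
qed

lemma t_unbounded: "\<exists>n. x < real (t n)"
proof -
  obtain n where "x < real n" using reals_Archimedean2 by blast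
  also have "real n < 2 ^ n" using of_nat_less_two_power .
  also have "\<dots> \<le> real (t n)" using power_le_t[of n] by (metis of_nat_le_iff of_nat_numeral of_nat_power)
  finally show ?thesis by blast
qed

lemma no_leaf_T: "\<forall>\<sigma>. \<not> is_leaf T \<sigma>"
  using two_le_card_succs by (fastforce simp: is_leaf_def)

sublocale Metric_space "paths T" "path_dist T"
  by (rule Metric_space_paths[OF tree_T fin_T no_leaf_T])

lemma path_dist_cases:
  assumes "f \<noteq> g"
  obtains m where "path_dist T f g = 1 / real (t m)" "\<And>n. restr f n = restr g n \<longleftrightarrow> n \<le> m"
proof -
  define m where "m = (GREATEST n. restr f n = restr g n)"
  obtain b where b: "\<And>n. restr f n = restr g n \<Longrightarrow> n \<le> b"
    using restr_bounded[OF assms] by blast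
  have "restr f m = restr g m" unfolding m_def
    by (rule GreatestI_nat[of _ 0]) (use b in \<open>auto simp: restr_def\<close>)
  moreover have "n \<le> m" if "restr f n = restr g n" for n
    unfolding m_def using that b by (rule Greatest_le_nat)
  ultimately have "restr f n = restr g n \<longleftrightarrow> n \<le> m" for n using restr_mono by blast
  moreover have "path_dist T f g = 1 / real (t m)" using assms by (simp add: path_dist_def m_def)
  ultimately show ?thesis using that by blast
qed

text \<open>Closed balls of radius \<open>1 / t n\<close> are thus the cylinders of level n.\<close>

lemma path_dist_le_iff: "path_dist T f g \<le> 1 / real (t n) \<longleftrightarrow> restr f n = restr g n"
proof (cases "f = g")
  case False
  then obtain m where m: "path_dist T f g = 1 / real (t m)" "\<And>n. restr f n = restr g n \<longleftrightarrow> n \<le> m"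
    using path_dist_cases by blast
  have "1 / real (t m) \<le> 1 / real (t n) \<longleftrightarrow> t n \<le> t m"
    using t_pos[of n] t_pos[of m] by (simp add: field_simps)
  then show ?thesis using m strict_mono_less_eq[OF strict_mono_t] by simp
qed (simp add: path_dist_def)

text \<open>A distance below \<open>1 / t n\<close> is at most \<open>1 / t (Suc n)\<close>, so open
  balls gain one level over closed ones. This shift puts \<open>s (Suc n)\<close> beside
  \<open>t n\<close> in the packing estimate.\<close>

lemma path_dist_less_iff: "path_dist T f g < 1 / real (t n) \<longleftrightarrow> restr f (Suc n) = restr g (Suc n)"
proof (cases "f = g")
  case False
  then obtain m where m: "path_dist T f g = 1 / real (t m)" "\<And>n. restr f n = restr g n \<longleftrightarrow> n \<le> m"
    using path_dist_cases by blast
  have "1 / real (t m) < 1 / real (t n) \<longleftrightarrow> t n < t m"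
    using t_pos[of n] t_pos[of m] by (simp add: field_simps)
  then show ?thesis using m strict_mono_less[OF strict_mono_t] by (simp add: Suc_le_eq)
qed (use t_pos[of n] in \<open>simp add: path_dist_def\<close>)

lemma paths_S_subset: "paths S \<subseteq> paths T"
  using level_S_subset by (auto simp: paths_def)

lemma extension_in_S:
  assumes "\<sigma> \<in> S"
  obtains k where "\<sigma> @ [k] \<in> S"
  using no_leaf_S[of \<sigma>] assms by (auto simp: is_leaf_def succs_def)

text \<open>The initial segment of length n of the limit is a prefix of \<open>\<sigma> n\<close>,
  hence in S. All paths below that are built by recursion come from here.\<close>

lemma limit_in_paths_S:
  assumes "\<And>k. strict_prefix (\<sigma> k) (\<sigma> (Suc k))" "\<And>k. \<sigma> k \<in> S"
  obtains f where "f \<in> paths S" "\<And>k. f \<in> cyl (\<sigma> k)"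
proof -
  obtain f where f: "\<And>k. restr f (length (\<sigma> k)) = \<sigma> k" using chain_limit[of \<sigma>] assms(1) by blast
  have "restr f n \<in> S" for n
    using prefix_restr[OF le_length_chain[of \<sigma> n], of f] assms(1) f[of n] assms(2)[of n] tree_S by (auto simp: is_tree_def)
  then have "f \<in> paths S" by (auto simp: paths_def level_def)
  then show ?thesis using that f paths_S_subset by (auto simp: cyl_def)
qed

lemma paths_S_nonempty: "paths S \<noteq> {}"
proof -
  have "\<exists>\<sigma>. \<forall>n. \<sigma> n \<in> S \<and> strict_prefix (\<sigma> n) (\<sigma> (Suc n))"
  proof (rule dependent_nat_choice)
    fix \<sigma> assume "\<sigma> \<in> S"
    then obtain k where "\<sigma> @ [k] \<in> S" by (rule extension_in_S)
    then show "\<exists>\<tau>. \<tau> \<in> S \<and> strict_prefix \<sigma> \<tau>"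
      by (intro exI[of _ "\<sigma> @ [k]"]) (auto simp: strict_prefix_def)
  qed (use Nil_in_S in blast)
  then obtain \<sigma> where "\<And>n. \<sigma> n \<in> S" "\<And>n. strict_prefix (\<sigma> n) (\<sigma> (Suc n))" by blast
  then show ?thesis using limit_in_paths_S[of \<sigma>] by blast
qed

text \<open>Level-wise uniformity enters here: it makes all terms of the sum over level n
  equal.\<close>

lemma card_succs_S:
  assumes "\<sigma> \<in> level S n"
  shows "s (Suc n) = card (succs S \<sigma>) * s n"
proof -
  have "s (Suc n) = (\<Sum>\<tau>\<in>level S n. card (succs S \<tau>))"
    unfolding level_Suc[OF tree_S] by (rule card_succs_disjoint_UN) (simp, simp add: level_def finite_succs_S)
  also have "\<dots> = (\<Sum>\<tau>\<in>level S n. card (succs S \<sigma>))"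
  proof (rule sum.cong)
    show "card (succs S \<tau>) = card (succs S \<sigma>)" if "\<tau> \<in> level S n" for \<tau>
      using uniform_S assms that unfolding levelwise_uniformly_branching_def by blast
  qed simp
  finally show ?thesis by simp
qed

lemma s_pos: "0 < s n"
proof -
  obtain f where "f \<in> paths S" using paths_S_nonempty by blast
  then have "restr f n \<in> level S n" by (simp add: paths_def)
  then show ?thesis using card_gt_0_iff finite_level_S by blast
qed

lemma level_S_nonempty [simp]: "level S n \<noteq> {}"
  using s_pos[of n] by auto

text \<open>Each node of level m has the proportion \<open>1 / s m\<close> of the nodes of a later
  level below it. The product form stays within the natural numbers.\<close>

lemma card_extensions:
  assumes "\<sigma> \<in> level S m" "m \<le> n"
  shows "card (extensions \<sigma> n) * s m = s n"
  using assms(2)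
proof (induction n rule: dec_induct)
  case base
  have "extensions \<sigma> m = {\<sigma>}"
    using assms(1) by (auto simp: extensions_def level_def) (metis not_equal_is_parallel parallelD1)
  then show ?case by simp
next
  case (step n)
  have "length \<sigma> \<le> n" using assms(1) step by (simp add: level_def)
  have "extensions \<sigma> (Suc n) = (\<Union>\<tau>\<in>extensions \<sigma> n. succs S \<tau>)"
  proof (intro equalityI subsetI)
    fix \<tau> assume "\<tau> \<in> extensions \<sigma> (Suc n)"
    then have t: "\<tau> \<in> level S (Suc n)" "prefix \<sigma> \<tau>" by (auto simp: extensions_def)
    then obtain \<rho> where r: "\<rho> \<in> level S n" "\<tau> \<in> succs S \<rho>" using level_Suc[OF tree_S] by blast
    then have "prefix \<sigma> \<rho>" using t(2) \<open>length \<sigma> \<le> n\<close> by (auto simp: succs_def level_def prefix_append)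
    then show "\<tau> \<in> (\<Union>\<tau>\<in>extensions \<sigma> n. succs S \<tau>)" using r by (auto simp: extensions_def)
  next
    fix \<tau> assume "\<tau> \<in> (\<Union>\<tau>\<in>extensions \<sigma> n. succs S \<tau>)"
    then show "\<tau> \<in> extensions \<sigma> (Suc n)"
      by (auto simp: extensions_def level_def succs_def)
  qed
  then have "card (extensions \<sigma> (Suc n)) * s m = (\<Sum>\<tau>\<in>extensions \<sigma> n. card (succs S \<tau>)) * s m"
    by (subst card_succs_disjoint_UN[symmetric]) (simp, simp add: extensions_def level_def finite_succs_S, simp)
  \<comment> \<open>With the factor \<open>s n\<close>, which is positive and cancels at the end,
    \<open>card_succs_S\<close> turns each summand into \<open>s (Suc n)\<close>.\<close>
  also have "\<dots> * s n = (\<Sum>\<tau>\<in>extensions \<sigma> n. card (succs S \<tau>) * s n) * s m"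
    by (simp only: sum_distrib_left mult.commute mult.left_commute)
  also have "(\<Sum>\<tau>\<in>extensions \<sigma> n. card (succs S \<tau>) * s n) = (\<Sum>\<tau>\<in>extensions \<sigma> n. s (Suc n))"
    by (rule sum.cong) (auto simp: extensions_def card_succs_S[symmetric])
  also have "\<dots> * s m = s (Suc n) * s n" using step by simp
  finally show ?case by simp
qed

section \<open>Covers by cylinders and the lower bound for the Hausdorff dimension\<close>

lemma covering_number_le_s:
  assumes "1 / real (t n) \<le> \<alpha>"
  shows "covering_number \<alpha> (paths S) \<le> enat (s n)"
proof -
  have "0 \<le> \<alpha>" using assms by (rule order_trans[rotated]) simp
  have "covering_number \<alpha> (paths S) \<le> enat (card (cyl ` level S n))"
  proof (rule covering_number_le)
    show "paths S \<subseteq> \<Union> (cyl ` level S n)"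
    proof
      fix f assume "f \<in> paths S"
      then have "f \<in> cyl (restr f n)" "restr f n \<in> level S n"
        using paths_S_subset by (auto simp: cyl_def paths_def[of S])
      then show "f \<in> \<Union> (cyl ` level S n)" by blast
    qed
    fix E assume "E \<in> cyl ` level S n"
    then obtain \<sigma> where E: "E = cyl \<sigma>" "length \<sigma> = n" by (auto simp: level_def)
    have "path_dist T f g \<le> \<alpha>" if "f \<in> E" "g \<in> E" for f g
      using that E assms path_dist_le_iff[of f g n] by (auto simp: cyl_def)
    then show "E \<subseteq> paths T \<and> mdiam E \<le> ennreal \<alpha>"
      using E \<open>0 \<le> \<alpha>\<close> by (auto simp: cyl_def mdiam_le_iff)
  qed simp
  also have "\<dots> \<le> enat (s n)" by (simp add: card_image_le)
  finally show ?thesis .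
qed

lemma log_card_quotient_le:
  assumes "1 / real (t n) \<le> \<alpha>" "\<alpha> < 1" "0 < \<alpha>"
  shows "log_card (covering_number \<alpha> (paths S)) / ereal (ln (1 / \<alpha>)) \<le> ereal (ln (real (s n)) / ln (1 / \<alpha>))"
proof -
  have "log_card (covering_number \<alpha> (paths S)) \<le> ereal (ln (real (s n)))"
    using log_card_mono[OF covering_number_le_s[OF assms(1)]] by (simp add: log_card_def[of "enat (s n)"])
  then have "log_card (covering_number \<alpha> (paths S)) / ereal (ln (1 / \<alpha>)) \<le> ereal (ln (real (s n))) / ereal (ln (1 / \<alpha>))"
    using assms by (intro ereal_divide_right_mono) auto
  then show ?thesis using assms by simp
qed

text \<open>If the weights below a node add up to less than \<open>1 / s n\<close>, the same holds for some
  successor on the next level; the path constructed in this way avoids all cylinders.\<close>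

lemma one_le_cylinder_cover:
  fixes c :: "'i \<Rightarrow> nat list"
  assumes cover: "paths S \<subseteq> (\<Union>i\<in>I. cyl (c i))"
  shows "1 \<le> (\<Sum>\<^sub>\<infinity>i\<in>I. ennreal (1 / real (s (length (c i)))))"
proof (rule ccontr)
  define w where "w i = ennreal (1 / real (s (length (c i))))" for i
  define W where "W \<sigma> = (\<Sum>\<^sub>\<infinity>i\<in>{i\<in>I. prefix \<sigma> (c i)}. w i)" for \<sigma>
  define good where "good \<sigma> \<longleftrightarrow> \<sigma> \<in> S \<and> W \<sigma> < ennreal (1 / real (s (length \<sigma>)))" for \<sigma>
  assume "\<not> 1 \<le> (\<Sum>\<^sub>\<infinity>i\<in>I. ennreal (1 / real (s (length (c i)))))"
  then have "good []" using Nil_in_S by (simp add: good_def W_def w_def level_S_0 not_le)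
  have step: "\<exists>\<tau>. good \<tau> \<and> \<tau> \<in> succs S \<sigma>" if "good \<sigma>" for \<sigma>
  proof (rule ccontr)
    assume no: "\<not> ?thesis"
    define n where "n = length \<sigma>"
    have \<sigma>: "\<sigma> \<in> level S n" "\<sigma> \<in> S" using that by (auto simp: good_def n_def level_def)
    have "ennreal (1 / real (s n)) = ennreal (real (card (succs S \<sigma>)) * (1 / real (s (Suc n))))"
      using card_succs_S[OF \<sigma>(1)] s_pos[of n] s_pos[of "Suc n"] by simp
    also have "\<dots> = (\<Sum>\<tau>\<in>succs S \<sigma>. ennreal (1 / real (s (Suc n))))"
      by (subst sum_ennreal) auto
    also have "\<dots> \<le> (\<Sum>\<tau>\<in>succs S \<sigma>. W \<tau>)"
    proof (rule sum_mono)
      fix \<tau> assume "\<tau> \<in> succs S \<sigma>"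
      then have "\<tau> \<in> S" "length \<tau> = Suc n" "\<tau> \<in> succs S \<sigma>" by (auto simp: succs_def n_def)
      then show "ennreal (1 / real (s (Suc n))) \<le> W \<tau>" using no by (auto simp: good_def not_less)
    qed
    also have "\<dots> = (\<Sum>\<^sub>\<infinity>i\<in>(\<Union>\<tau>\<in>succs S \<sigma>. {i\<in>I. prefix \<tau> (c i)}). w i)"
      unfolding W_def
    proof (rule sum_infsum)
      fix \<tau> \<tau>' assume "\<tau> \<in> succs S \<sigma>" "\<tau>' \<in> succs S \<sigma>" "\<tau> \<noteq> \<tau>'"
      then show "{i\<in>I. prefix \<tau> (c i)} \<inter> {i\<in>I. prefix \<tau>' (c i)} = {}"
        by (auto simp: succs_def prefix_def)
    qed (use finite_succs_S \<sigma> in auto)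
    also have "\<dots> \<le> W \<sigma>"
      unfolding W_def by (rule infsum_mono_set_ennreal) (auto simp: succs_def dest: append_prefixD)
    finally show False using that by (simp add: good_def n_def not_less[symmetric])
  qed
  have "\<exists>\<sigma>. \<forall>n. (good (\<sigma> n) \<and> length (\<sigma> n) = n) \<and> strict_prefix (\<sigma> n) (\<sigma> (Suc n))"
  proof (rule dependent_nat_choice)
    fix \<sigma> n assume "good \<sigma> \<and> length \<sigma> = n"
    then obtain \<tau> where "good \<tau>" "\<tau> \<in> succs S \<sigma>" "length \<sigma> = n" using step by blast
    then show "\<exists>\<tau>. (good \<tau> \<and> length \<tau> = Suc n) \<and> strict_prefix \<sigma> \<tau>"
      by (intro exI[of _ \<tau>]) (auto simp: succs_def strict_prefix_def)
  qed (use \<open>good []\<close> in auto)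
  then obtain \<sigma> where \<sigma>: "\<And>n. good (\<sigma> n)" "\<And>n. length (\<sigma> n) = n"
      "\<And>n. strict_prefix (\<sigma> n) (\<sigma> (Suc n))"
    by blast
  then obtain f where f: "f \<in> paths S" "\<And>k. f \<in> cyl (\<sigma> k)"
    using limit_in_paths_S[of \<sigma>] unfolding good_def by blast
  obtain i where i: "i \<in> I" "f \<in> cyl (c i)" using cover f(1) by blast
  \<comment> \<open>A cylinder containing f belongs to a node of the constructed chain, where the
    single weight \<open>w i\<close> already exceeds the total \<open>W\<close>.\<close>
  then have "c i = \<sigma> (length (c i))"
    using f(2)[of "length (c i)"] \<sigma>(2) by (simp add: cyl_def)
  then have "W (c i) < w i" using \<sigma>(1)[of "length (c i)"] by (simp add: good_def w_def)
  moreover have "w i \<le> W (c i)" unfolding W_def using i by (intro member_le_infsum_ennreal) auto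
  ultimately show False by simp
qed

text \<open>If E has two points, the largest distance \<open>1 / t m\<close> in E is attained, E
  lies in one cylinder of level m, and \<open>growth\<close> bounds the mass \<open>1 / s m\<close>
  by the weight of E. If E has at most one point, its weight is 0 for r > 0; the slack \<delta> then
  pays for a sufficiently deep cylinder.\<close>

lemma cylinder_of_small_set:
  assumes growth: "\<And>n. n0 \<le> n \<Longrightarrow> real (t n) powr r \<le> real (s n)"
    and "0 \<le> r" "E \<subseteq> paths T" "mdiam E \<le> ennreal (1 / real (t n0))" "0 < \<delta>"
  obtains \<tau> where "E \<subseteq> cyl \<tau>" "ennreal (1 / real (s (length \<tau>))) \<le> diam_pow r E + ennreal \<delta>"
proof (cases "\<exists>f\<in>E. \<exists>g\<in>E. f \<noteq> g")
  case True
  define P where "P n \<longleftrightarrow> (\<exists>f\<in>E. \<exists>g\<in>E. f \<noteq> g \<and> path_dist T f g = 1 / real (t n))" for n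
  have "\<exists>n. P n" using True unfolding P_def using path_dist_cases by meson
  \<comment> \<open>The least separation level within E belongs to its largest distance.\<close>
  define m where "m = (LEAST n. P n)"
  have "P m" unfolding m_def using \<open>\<exists>n. P n\<close> by (rule LeastI_ex)
  then obtain f g where fg: "f \<in> E" "g \<in> E" "path_dist T f g = 1 / real (t m)"
    by (auto simp: P_def)
  have "restr h m = restr f m" if "h \<in> E" for h
  proof (cases "h = f")
    case False
    then obtain k where k: "path_dist T h f = 1 / real (t k)" "\<And>n. restr h n = restr f n \<longleftrightarrow> n \<le> k"
      using path_dist_cases by blast
    then have "P k" using that fg(1) False by (auto simp: P_def)
    then have "m \<le> k" unfolding m_def by (rule Least_le)
    then show ?thesis using k by simp
  qed simp
  then have E: "E \<subseteq> cyl (restr f m)" using assms(3) by (auto simp: cyl_def)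
  have "n0 \<le> m"
  proof -
    have "1 / real (t m) \<le> 1 / real (t n0)" using assms(4) fg by (metis mdiam_le_iff divide_nonneg_nonneg of_nat_0_le_iff zero_le_one)
    then have "t n0 \<le> t m" using t_pos[of m] t_pos[of n0] by (simp add: field_simps)
    then show ?thesis using strict_mono_less_eq[OF strict_mono_t] by simp
  qed
  have "ennreal (1 / real (s m)) \<le> ennreal ((1 / real (t m)) powr r)"
    using growth[OF \<open>n0 \<le> m\<close>] t_pos[of m] s_pos[of m]
    by (intro ennreal_leI) (simp add: powr_divide frac_le)
  also have "\<dots> \<le> diam_pow r E"
    using diam_pow_ge[OF fg(1,2) assms(4) _ assms(2)] t_pos[of m] fg(3) by simp
  finally have "ennreal (1 / real (s m)) \<le> diam_pow r E + ennreal \<delta>" by (simp add: add_increasing2)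
  then show ?thesis using that E by simp
next
  case False
  have "\<exists>n. ennreal (1 / real (s n)) \<le> diam_pow r E + ennreal \<delta>"
  proof (cases "r = 0")
    case True
    \<comment> \<open>For r = 0 the weight is 1 even when the diameter is 0, which is the mass of
      the root.\<close>
    have "ennreal (1 / real (s 0)) \<le> diam_pow r E" using True by (simp add: level_S_0 diam_pow_def)
    then show ?thesis by (meson add_increasing2 zero_le)
  next
    case False
    \<comment> \<open>Chosen so that \<open>(t n) powr r\<close>, and with it \<open>s n\<close>, is
      at least \<open>1 / \<delta>\<close>.\<close>
    obtain k where k: "(1 / \<delta>) powr (1 / r) < real (t k)" using t_unbounded by blast
    define n where "n = max n0 k"
    have "t k \<le> t n" using strict_mono_less_eq[OF strict_mono_t] n_def by simp
    then have "((1 / \<delta>) powr (1 / r)) powr r \<le> real (t n) powr r"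
      using k assms(2) by (intro powr_mono2) auto
    also have "\<dots> \<le> real (s n)" by (rule growth) (simp add: n_def)
    finally have "1 / real (s n) \<le> \<delta>"
      using False assms(5) s_pos[of n] by (simp add: powr_powr field_simps)
    then show ?thesis by (meson add_increasing ennreal_leI zero_le)
  qed
  then obtain n where n: "ennreal (1 / real (s n)) \<le> diam_pow r E + ennreal \<delta>" by blast
  \<comment> \<open>If E is empty, \<open>SOME\<close> is arbitrary and the inclusion trivial; only
    the length n of the string matters.\<close>
  have "E \<subseteq> cyl (restr (SOME f. f \<in> E) n)"
  proof
    fix f assume "f \<in> E"
    then have "(SOME f. f \<in> E) = f" using False by (metis someI)
    then show "f \<in> cyl (restr (SOME f. f \<in> E) n)" using assms(3) \<open>f \<in> E\<close> by (auto simp: cyl_def)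
  qed
  then show ?thesis using that n by simp
qed

text \<open>Enlarging each set of a cover to a cylinder costs at most \<open>\<delta> i\<close>, and
  at most e in total, so the claim reduces to \<open>one_le_cylinder_cover\<close>.\<close>

lemma one_le_hausdorff_pre:
  assumes growth: "\<And>n. n0 \<le> n \<Longrightarrow> real (t n) powr r \<le> real (s n)" and "0 \<le> r"
  shows "1 \<le> hausdorff_pre r (1 / real (t n0)) (paths S)"
  unfolding hausdorff_pre_def
proof (rule INF_greatest, clarify, rule ennreal_le_epsilon)
  fix I :: "nat set" and E and e :: real
  assume cover: "paths S \<subseteq> (\<Union>i\<in>I. E i)"
    and E: "\<forall>i\<in>I. E i \<subseteq> paths T \<and> mdiam (E i) \<le> ennreal (1 / real (t n0))" and "0 < e"
  define \<delta> where "\<delta> i = e * (1/2) ^ Suc i" for i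
  have "0 < \<delta> i" for i using \<open>0 < e\<close> by (simp add: \<delta>_def)
  have "\<forall>i\<in>I. \<exists>\<tau>. E i \<subseteq> cyl \<tau> \<and> ennreal (1 / real (s (length \<tau>))) \<le> diam_pow r (E i) + ennreal (\<delta> i)"
  proof
    fix i assume "i \<in> I"
    then have "E i \<subseteq> paths T" "mdiam (E i) \<le> ennreal (1 / real (t n0))" using E by auto
    from cylinder_of_small_set[OF growth \<open>0 \<le> r\<close> this \<open>0 < \<delta> i\<close>]
    show "\<exists>\<tau>. E i \<subseteq> cyl \<tau> \<and> ennreal (1 / real (s (length \<tau>))) \<le> diam_pow r (E i) + ennreal (\<delta> i)"
      by blast
  qed
  then obtain c where c: "\<And>i. i \<in> I \<Longrightarrow> E i \<subseteq> cyl (c i)"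
      "\<And>i. i \<in> I \<Longrightarrow> ennreal (1 / real (s (length (c i)))) \<le> diam_pow r (E i) + ennreal (\<delta> i)"
    by metis
  have "(\<Sum>\<^sub>\<infinity>i\<in>I. ennreal (\<delta> i)) \<le> ennreal e"
  proof (rule infsum_le_finite_sums)
    fix F :: "nat set" assume "finite F"
    then obtain n where n: "F \<subseteq> {..<n}" using finite_nat_bounded by blast
    have "(\<Sum>i\<in>F. \<delta> i) \<le> (\<Sum>i<n. \<delta> i)"
      using n \<open>\<And>i. 0 < \<delta> i\<close> by (intro sum_mono2) (auto simp: less_imp_le)
    also have "\<dots> = e * (1 - (1/2) ^ n)"
      by (induction n) (simp_all add: \<delta>_def algebra_simps)
    also have "\<dots> \<le> e" using \<open>0 < e\<close> by (simp add: algebra_simps)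
    finally show "(\<Sum>i\<in>F. ennreal (\<delta> i)) \<le> ennreal e"
      using \<open>\<And>i. 0 < \<delta> i\<close> by (simp add: sum_ennreal ennreal_leI less_imp_le)
  qed simp
  moreover have "1 \<le> (\<Sum>\<^sub>\<infinity>i\<in>I. ennreal (1 / real (s (length (c i)))))"
    by (rule one_le_cylinder_cover) (use cover c(1) in blast)
  moreover have "\<dots> \<le> (\<Sum>\<^sub>\<infinity>i\<in>I. diam_pow r (E i) + ennreal (\<delta> i))"
    using c(2) by (intro infsum_mono) auto
  moreover have "\<dots> = (\<Sum>\<^sub>\<infinity>i\<in>I. diam_pow r (E i)) + (\<Sum>\<^sub>\<infinity>i\<in>I. ennreal (\<delta> i))"
    by (rule infsum_add) auto
  ultimately show "1 \<le> (\<Sum>\<^sub>\<infinity>i\<in>I. diam_pow r (E i)) + ennreal e"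
    by (metis (no_types, lifting) add_left_mono order_trans)
qed

lemma le_hausdorff_dim:
  assumes growth: "\<And>n. n0 \<le> n \<Longrightarrow> real (t n) powr r \<le> real (s n)" and "0 \<le> r"
  shows "ereal r \<le> hausdorff_dim (paths S)"
proof -
  have "1 \<le> hausdorff_meas r (paths S)"
    unfolding hausdorff_meas_eq_SUP
    using one_le_hausdorff_pre[of n0 r] growth assms(2) t_pos[of n0]
    by (intro SUP_upper2[of "1 / real (t n0)"]) auto
  then have "0 < hausdorff_meas r (paths S)" by (rule less_le_trans[rotated]) simp
  then show ?thesis unfolding hausdorff_dim_def using assms(2) by (intro Sup_upper) auto
qed

lemma filterlim_inverse_t: "filterlim (\<lambda>n. 1 / real (t n)) (at_right 0) sequentially"
proof -
  have "filterlim (\<lambda>n. real (t n)) at_top sequentially"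
    by (rule filterlim_compose[OF filterlim_real_sequentially filterlim_subseq[OF strict_mono_t]])
  from filterlim_compose[OF filterlim_inverse_at_right_top this]
  show ?thesis by (simp add: inverse_eq_divide)
qed

lemma one_less_t: "1 \<le> n \<Longrightarrow> 1 < real (t n)"
  using strict_mono_less[OF strict_mono_t, of 0 n] by (simp add: level_T_0)

text \<open>Below the lower box dimension, the quotient at the scales \<open>1 / t n\<close> is
  eventually above r. Since the covering number there is at most \<open>s n\<close>, this is the
  growth that \<open>le_hausdorff_dim\<close> requires.\<close>

lemma lower_box_dim_le_hausdorff_dim: "lower_box_dim (paths S) \<le> hausdorff_dim (paths S)"
proof (rule ccontr)
  assume "\<not> ?thesis"
  then obtain r where r: "hausdorff_dim (paths S) < ereal r" "ereal r < lower_box_dim (paths S)"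
    using ereal_dense2 by (metis not_le)
  have "ereal 0 \<le> hausdorff_dim (paths S)"
    by (rule le_hausdorff_dim[of 0]) (use s_pos t_pos in \<open>auto simp: Suc_le_eq\<close>)
  then have "0 \<le> r" using r(1) by (metis ereal_less_eq(3) less_imp_le order_trans)
  have "\<forall>\<^sub>F \<alpha> in at_right 0. ereal r < log_card (covering_number \<alpha> (paths S)) / ereal (ln (1 / \<alpha>))"
    using r(2) unfolding lower_box_dim_def by (rule less_LiminfD)
  then have "\<forall>\<^sub>F n in sequentially. ereal r <
      log_card (covering_number (1 / real (t n)) (paths S)) / ereal (ln (1 / (1 / real (t n))))"
    by (rule eventually_compose_filterlim[OF _ filterlim_inverse_t])
  then obtain n0 where n0: "\<And>n. n0 \<le> n \<Longrightarrow> ereal r <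
      log_card (covering_number (1 / real (t n)) (paths S)) / ereal (ln (1 / (1 / real (t n))))"
    by (auto simp: eventually_sequentially)
  have "ereal r \<le> hausdorff_dim (paths S)"
  proof (rule le_hausdorff_dim[OF _ \<open>0 \<le> r\<close>])
    \<comment> \<open>Level 0 is excluded because \<open>t 0\<close> is 1, where the logarithm
      vanishes.\<close>
    fix n assume n: "max n0 1 \<le> n"
    then have t1: "1 < real (t n)" by (intro one_less_t) simp
    have "ereal r < ereal (ln (real (s n)) / ln (1 / (1 / real (t n))))"
      by (rule less_le_trans[OF n0 log_card_quotient_le]) (use n t1 in auto)
    then have "r * ln (real (t n)) < ln (real (s n))"
      using t1 by (simp add: pos_less_divide_eq)
    then have "ln (real (t n) powr r) \<le> ln (real (s n))" using t1 by (simp add: ln_powr)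
    then show "real (t n) powr r \<le> real (s n)"
      using t1 s_pos[of n] by (subst (asm) ln_le_cancel_iff) auto
  qed
  with r(1) show False by simp
qed

section \<open>The lower bound for the packing dimension\<close>

text \<open>Density gives a centre in U for each of the \<open>s (Suc n) / s m\<close> nodes of
  level \<open>Suc n\<close> below \<sigma>, where m is the length of \<sigma>. The balls of radius
  \<open>1 / t n\<close> around them are disjoint, and for suitable n their total weight exceeds
  \<open>(t n) powr (r' - r) / s m\<close>, which is unbounded.\<close>

lemma packing_pre_eq_top:
  assumes r: "0 \<le> r" "r < r'"
    and growth: "\<And>k. \<exists>n\<ge>k. real (t n) powr r' < real (s (Suc n))"
    and \<sigma>: "\<sigma> \<in> S" and dense: "\<And>\<tau>. \<tau> \<in> S \<Longrightarrow> prefix \<sigma> \<tau> \<Longrightarrow> U \<inter> cyl \<tau> \<noteq> {}"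
    and "0 < \<alpha>"
  shows "packing_pre r \<alpha> U = top"
proof (rule ccontr)
  assume "packing_pre r \<alpha> U \<noteq> top"
  then obtain B where B: "0 \<le> B" "packing_pre r \<alpha> U = ennreal B"
    using ennreal_cases[of "packing_pre r \<alpha> U"] by auto
  define m where "m = length \<sigma>"
  have \<sigma>m: "\<sigma> \<in> level S m" using \<sigma> by (simp add: level_def m_def)
  \<comment> \<open>Beyond \<open>k1\<close> the diameter \<open>2 / t n\<close> is admissible;
    beyond \<open>k2\<close> the power \<open>(t n) powr (r' - r)\<close> exceeds
    \<open>B * s m\<close>, contradicting the supposed bound B.\<close>
  obtain k1 where k1: "2 / \<alpha> < real (t k1)" using t_unbounded by blast
  obtain k2 where k2: "(B * real (s m)) powr (1 / (r' - r)) < real (t k2)" using t_unbounded by blast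
  obtain n where n: "max m (max k1 k2) \<le> n" "real (t n) powr r' < real (s (Suc n))"
    using growth by blast
  have mono: "real (t k) \<le> real (t n)" if "k \<le> n" for k
    using that strict_mono_less_eq[OF strict_mono_t] by simp
  have tn: "0 < real (t n)" using t_pos by simp
  define N where "N = card (extensions \<sigma> (Suc n))"
  define c where "c \<tau> = (SOME f. f \<in> U \<inter> cyl \<tau>)" for \<tau>
  obtain e where e: "bij_betw e {0..<N} (extensions \<sigma> (Suc n))"
    using ex_bij_betw_nat_finite[of "extensions \<sigma> (Suc n)"] by (auto simp: N_def)
  have c: "c (e i) \<in> U" "c (e i) \<in> paths T" "restr (c (e i)) (Suc n) = e i" if "i < N" for i
  proof -
    have "e i \<in> extensions \<sigma> (Suc n)" using e that by (auto simp: bij_betw_def)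
    then have ei: "e i \<in> S" "prefix \<sigma> (e i)" "length (e i) = Suc n"
      by (auto simp: extensions_def level_def)
    have "c (e i) \<in> U \<inter> cyl (e i)" unfolding c_def using dense[OF ei(1,2)] by (rule some_in_eq[THEN iffD2])
    then show "c (e i) \<in> U" "c (e i) \<in> paths T" "restr (c (e i)) (Suc n) = e i"
      using ei by (auto simp: cyl_def)
  qed
  have "real N * (2 / real (t n)) powr r \<le> B"
  proof -
    have "ennreal (real N * (2 / real (t n)) powr r)
        = (\<Sum>\<^sub>\<infinity>i\<in>{0..<N}. ennreal ((2 * (1 / real (t n))) powr r))"
      by (simp add: ennreal_mult ennreal_of_nat_eq_real_of_nat)
    also have "\<dots> \<le> packing_pre r \<alpha> U"
      unfolding packing_pre_def
    proof (rule SUP_upper2[of "({0..<N}, c \<circ> e, \<lambda>_. 1 / real (t n))"], clarsimp, intro conjI ballI impI)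
      have "2 / \<alpha> < real (t n)" using k1 mono[of k1] n(1) by simp
      then show "2 / real (t n) \<le> \<alpha>" using \<open>0 < \<alpha>\<close> tn by (simp add: field_simps)
      show "disjoint_family_on (\<lambda>i. mball (c (e i)) (1 / real (t n))) {0..<N}"
      proof (unfold disjoint_family_on_def, intro ballI impI, rule ccontr)
        fix i j assume ij: "i \<in> {0..<N}" "j \<in> {0..<N}" "i \<noteq> j"
          and "mball (c (e i)) (1 / real (t n)) \<inter> mball (c (e j)) (1 / real (t n)) \<noteq> {}"
        then obtain f where "path_dist T (c (e i)) f < 1 / real (t n)" "path_dist T (c (e j)) f < 1 / real (t n)"
          by auto
        \<comment> \<open>A common point shares its initial segment of length \<open>Suc n\<close>
          with both centres.\<close>
        then have "e i = e j" using c(3) ij by (simp add: path_dist_less_iff)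
        then show False using e ij by (auto simp: bij_betw_def inj_on_def)
      qed
    qed (use c t_pos in \<open>auto simp: ennreal_mult ennreal_of_nat_eq_real_of_nat\<close>)
    finally show ?thesis using B by (simp add: ennreal_le_iff)
  qed
  moreover have "B < real N * (2 / real (t n)) powr r"
  proof -
    have sm: "0 < real (s m)" using s_pos by simp
    have "B * real (s m) = ((B * real (s m)) powr (1 / (r' - r))) powr (r' - r)"
      using r B sm by (simp add: powr_powr)
    also have "\<dots> < real (t n) powr (r' - r)"
      using r k2 mono[of k2] n(1) by (intro powr_less_mono2) auto
    also have "\<dots> = real (t n) powr r' * (1 / real (t n)) powr r"
      using tn by (simp add: powr_diff powr_divide)
    also have "\<dots> \<le> real (s (Suc n)) * (2 / real (t n)) powr r"
      using n(2) r tn by (intro mult_mono powr_mono2) (auto simp: divide_right_mono)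
    also have "real (s (Suc n)) = real N * real (s m)"
      using card_extensions[OF \<sigma>m, of "Suc n"] n(1) by (simp add: N_def of_nat_mult[symmetric] del: of_nat_mult)
    finally have "B * real (s m) < (real N * (2 / real (t n)) powr r) * real (s m)" by (simp add: mult_ac)
    then show ?thesis using sm by simp
  qed
  ultimately show False by simp
qed

text \<open>The Baire category argument: otherwise some path would leave all members of the cover.\<close>

lemma dense_in_some_cylinder:
  assumes "countable \<U>" "paths S \<subseteq> \<Union>\<U>"
  shows "\<exists>U\<in>\<U>. \<exists>\<sigma>\<in>S. \<forall>\<tau>\<in>S. prefix \<sigma> \<tau> \<longrightarrow> U \<inter> cyl \<tau> \<noteq> {}"
proof (rule ccontr)
  assume "\<not> ?thesis"
  then have avoid: "\<exists>\<tau>\<in>S. prefix \<sigma> \<tau> \<and> U \<inter> cyl \<tau> = {}" if "U \<in> \<U>" "\<sigma> \<in> S" for U \<sigma>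
    using that by blast
  \<comment> \<open>Needed for \<open>from_nat_into\<close> to stay in the cover; it lists every
    member, with repetitions if there are finitely many.\<close>
  have "\<U> \<noteq> {}" using assms(2) paths_S_nonempty by auto
  have "\<exists>\<sigma>. \<forall>n. \<sigma> n \<in> S \<and> strict_prefix (\<sigma> n) (\<sigma> (Suc n)) \<and> from_nat_into \<U> n \<inter> cyl (\<sigma> (Suc n)) = {}"
  proof (rule dependent_nat_choice)
    fix \<sigma> n assume "\<sigma> \<in> S"
    then obtain \<tau> where \<tau>: "\<tau> \<in> S" "prefix \<sigma> \<tau>" "from_nat_into \<U> n \<inter> cyl \<tau> = {}"
      using avoid from_nat_into[OF \<open>\<U> \<noteq> {}\<close>] by blast
    \<comment> \<open>The extension \<tau> may be \<sigma> itself; one more entry makes the chain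
      strict and only shrinks the cylinder.\<close>
    obtain k where k: "\<tau> @ [k] \<in> S" using extension_in_S[OF \<tau>(1)] .
    have "restr f (length \<tau>) = \<tau>" if "restr f (Suc (length \<tau>)) = \<tau> @ [k]" for f
      using that by (simp add: restr_def)
    then have "cyl (\<tau> @ [k]) \<subseteq> cyl \<tau>" by (auto simp: cyl_def)
    moreover have "strict_prefix \<sigma> (\<tau> @ [k])" using \<tau>(2) by (auto simp: strict_prefix_def prefix_def)
    ultimately show "\<exists>\<tau>. \<tau> \<in> S \<and> strict_prefix \<sigma> \<tau> \<and> from_nat_into \<U> n \<inter> cyl \<tau> = {}"
      using \<tau>(3) k by blast
  qed (use Nil_in_S in blast)
  then obtain \<sigma> where \<sigma>: "\<And>n. \<sigma> n \<in> S" "\<And>n. strict_prefix (\<sigma> n) (\<sigma> (Suc n))"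
      "\<And>n. from_nat_into \<U> n \<inter> cyl (\<sigma> (Suc n)) = {}"
    by blast
  then obtain f where f: "f \<in> paths S" "\<And>k. f \<in> cyl (\<sigma> k)" using limit_in_paths_S[of \<sigma>] by blast
  then obtain U where "U \<in> \<U>" "f \<in> U" using assms(2) by blast
  then obtain n where "f \<in> from_nat_into \<U> n" using from_nat_into_surj[OF assms(1)] by metis
  then show False using f(2)[of "Suc n"] \<sigma>(3)[of n] by blast
qed

text \<open>The one large member already bounds the sum over the cover. The bound 1 also suits r =
  0, where a single ball counts 1.\<close>

lemma le_packing_dim:
  assumes "0 \<le> r"
    and large: "\<And>\<U>. countable \<U> \<Longrightarrow> paths S \<subseteq> \<Union>\<U> \<Longrightarrow> \<forall>U\<in>\<U>. U \<subseteq> paths T \<Longrightarrow>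
      \<exists>U\<in>\<U>. \<forall>\<alpha>>0. 1 \<le> packing_pre r \<alpha> U"
  shows "ereal r \<le> packing_dim (paths S)"
proof -
  have "1 \<le> packing_meas r (paths S)"
    unfolding packing_meas_def
  proof (rule INF_greatest, clarify)
    fix \<U> assume \<U>: "countable \<U>" "\<forall>U\<in>\<U>. U \<subseteq> paths T" "paths S \<subseteq> \<Union>\<U>"
    obtain U where U: "U \<in> \<U>" "\<And>\<alpha>. 0 < \<alpha> \<Longrightarrow> 1 \<le> packing_pre r \<alpha> U"
      using large[OF \<U>(1,3,2)] by blast
    have "1 \<le> (INF \<alpha>\<in>{0<..}. packing_pre r \<alpha> U)"
      using U(2) by (intro INF_greatest) auto
    also have "\<dots> = Lim (at_right 0) (\<lambda>\<alpha>. packing_pre r \<alpha> U)"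
      by (rule tendsto_Lim[OF _ tendsto_packing_pre, symmetric]) simp
    also have "\<dots> \<le> (\<Sum>\<^sub>\<infinity>U\<in>\<U>. Lim (at_right 0) (\<lambda>\<alpha>. packing_pre r \<alpha> U))"
      using U(1) by (rule member_le_infsum_ennreal)
    finally show "1 \<le> (\<Sum>\<^sub>\<infinity>U\<in>\<U>. Lim (at_right 0) (\<lambda>\<alpha>. packing_pre r \<alpha> U))" .
  qed
  then have "0 < packing_meas r (paths S)" by (rule less_le_trans[rotated]) simp
  then show ?thesis unfolding packing_dim_def using assms(1) by (intro Sup_upper) auto
qed

text \<open>A cover of a nonempty set has a nonempty member, and one ball of positive radius centred
  there has weight 1 for the exponent 0.\<close>

lemma zero_le_packing_dim: "ereal 0 \<le> packing_dim (paths S)"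
proof (rule le_packing_dim)
  fix \<U> assume "paths S \<subseteq> \<Union>\<U>"
  then obtain U f where U: "U \<in> \<U>" "f \<in> U" using paths_S_nonempty by blast
  have "1 \<le> packing_pre 0 \<alpha> U" if "0 < \<alpha>" for \<alpha>
    unfolding packing_pre_def
    by (rule SUP_upper2[of "({0}, \<lambda>_. f, \<lambda>_. \<alpha> / 2)"])
       (use U that in \<open>auto simp: disjoint_family_on_def\<close>)
  then show "\<exists>U\<in>\<U>. \<forall>\<alpha>>0. 1 \<le> packing_pre 0 \<alpha> U" using U by blast
qed simp

text \<open>At a small scale \<alpha> with quotient above r, let n be least with
  \<open>1 / t n \<le> \<alpha>\<close>. Cylinders of level n cover at scale \<alpha>, so
  \<open>(1 / \<alpha>) powr r < s n\<close>, while the preceding level p still has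
  \<open>t p \<le> 1 / \<alpha>\<close>. The shift by one level arises because \<alpha> may lie
  anywhere between \<open>1 / t n\<close> and \<open>1 / t p\<close>.\<close>

lemma growth_of_upper_box_dim:
  assumes "ereal r < upper_box_dim (paths S)" "0 \<le> r"
  shows "\<exists>n\<ge>k. real (t n) powr r < real (s (Suc n))"
proof -
  define Q where "Q \<alpha> = log_card (covering_number \<alpha> (paths S)) / ereal (ln (1 / \<alpha>))" for \<alpha>
  have "\<not> (\<forall>\<^sub>F \<alpha> in at_right 0. Q \<alpha> \<le> ereal r)"
    using Limsup_bounded[of Q "ereal r" "at_right 0"] assms(1)
    by (auto simp: upper_box_dim_def Q_def[abs_def])
  then have "\<exists>\<^sub>F \<alpha> in at_right 0. ereal r < Q \<alpha>"
    by (simp add: frequently_def not_less)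
  moreover have "\<forall>\<^sub>F \<alpha> in at_right 0. \<alpha> \<in> {0<..<1 / real (t k)}"
    using t_pos by (intro eventually_at_right_real) simp
  ultimately obtain \<alpha> where \<alpha>: "ereal r < Q \<alpha>" "0 < \<alpha>" "\<alpha> < 1 / real (t k)"
    using frequently_ex[OF frequently_eventually_conj] by fastforce
  have "1 / real (t k) \<le> 1" using t_pos[of k] by simp
  then have "\<alpha> < 1" using \<alpha> by linarith
  define n where "n = (LEAST n. 1 / real (t n) \<le> \<alpha>)"
  obtain j where "1 / \<alpha> < real (t j)" using t_unbounded by blast
  then have "1 / real (t j) \<le> \<alpha>" using \<alpha> t_pos[of j] by (simp add: field_simps)
  then have n: "1 / real (t n) \<le> \<alpha>" unfolding n_def by (rule LeastI)
  \<comment> \<open>The choice of \<alpha> below \<open>1 / t k\<close> forces n beyond k, so a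
    preceding level exists and is at least k.\<close>
  then have "1 / real (t n) < 1 / real (t k)" using \<alpha> by linarith
  then have "t k < t n" using t_pos[of n] t_pos[of k] by (simp add: field_simps)
  then have "k < n" using strict_mono_less[OF strict_mono_t] by simp
  then obtain p where p: "n = Suc p" "k \<le> p" by (cases n) auto
  have "\<not> 1 / real (t p) \<le> \<alpha>" using p unfolding n_def by (intro not_less_Least) simp
  then have tp: "real (t p) \<le> 1 / \<alpha>" using \<alpha> t_pos[of p] by (simp add: field_simps)
  have "ereal r < ereal (ln (real (s n)) / ln (1 / \<alpha>))"
    using less_le_trans[OF \<alpha>(1)[unfolded Q_def] log_card_quotient_le[OF n \<open>\<alpha> < 1\<close> \<alpha>(2)]] .
  then have "r * ln (1 / \<alpha>) < ln (real (s n))"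
    using \<alpha>(2) \<open>\<alpha> < 1\<close> by (simp add: pos_less_divide_eq)
  then have "ln ((1 / \<alpha>) powr r) < ln (real (s n))" using \<alpha>(2) by (simp add: ln_powr)
  then have "(1 / \<alpha>) powr r < real (s n)"
    using \<alpha>(2) s_pos[of n] by (subst (asm) ln_less_cancel_iff) auto
  moreover have "real (t p) powr r \<le> (1 / \<alpha>) powr r"
    using tp assms(2) by (intro powr_mono2) auto
  ultimately show ?thesis using p by (intro exI[of _ p]) auto
qed

text \<open>Two exponents are placed in the supposed gap: r' supplies the growth, and its excess
  over r makes the premeasure for r infinite.\<close>

lemma upper_box_dim_le_packing_dim: "upper_box_dim (paths S) \<le> packing_dim (paths S)"
proof (rule ccontr)
  assume "\<not> ?thesis"
  then obtain r where r: "packing_dim (paths S) < ereal r" "ereal r < upper_box_dim (paths S)"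
    using ereal_dense2 by (metis not_le)
  obtain r' where r': "ereal r < ereal r'" "ereal r' < upper_box_dim (paths S)"
    using ereal_dense2[OF r(2)] by blast
  have "0 \<le> r" using r(1) zero_le_packing_dim by (metis ereal_less_eq(3) less_imp_le order_trans)
  have "ereal r \<le> packing_dim (paths S)"
  proof (rule le_packing_dim[OF \<open>0 \<le> r\<close>])
    fix \<U> assume "countable \<U>" "paths S \<subseteq> \<Union>\<U>"
    then obtain U \<sigma> where U: "U \<in> \<U>" "\<sigma> \<in> S" "\<And>\<tau>. \<tau> \<in> S \<Longrightarrow> prefix \<sigma> \<tau> \<Longrightarrow> U \<inter> cyl \<tau> \<noteq> {}"
      using dense_in_some_cylinder by metis
    have "packing_pre r \<alpha> U = top" if "0 < \<alpha>" for \<alpha>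
    proof (rule packing_pre_eq_top[OF \<open>0 \<le> r\<close> _ _ U(2,3) that])
      show "r < r'" using r'(1) by simp
      then show "\<exists>n\<ge>k. real (t n) powr r' < real (s (Suc n))" for k
        using growth_of_upper_box_dim[OF r'(2)] \<open>0 \<le> r\<close> by simp
    qed
    with U(1) show "\<exists>U\<in>\<U>. \<forall>\<alpha>>0. 1 \<le> packing_pre r \<alpha> U" by (intro bexI[of _ U]) simp_all
  qed
  with r(1) show False by simp
qed

end

theorem theorem2p1:
  fixes S T :: "nat list set"
  assumes "is_tree S" and "is_tree T" and "S \<subseteq> T"
    and "finitely_branching T"
    and "\<forall>\<sigma>\<in>T. 2 \<le> card (succs T \<sigma>)"
    and "\<forall>\<sigma>. \<not> is_leaf S \<sigma>"
    and "levelwise_uniformly_branching S"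
  shows "Metric_space.hausdorff_dim (paths T) (path_dist T) (paths S)
           = Metric_space.lower_box_dim (paths T) (path_dist T) (paths S)
       \<and> Metric_space.packing_dim (paths T) (path_dist T) (paths S)
           = Metric_space.upper_box_dim (paths T) (path_dist T) (paths S)"
proof -
  interpret uniform_subtree S T by unfold_locales (use assms in blast)+
  show ?thesis
    using hausdorff_dim_le_lower_box_dim lower_box_dim_le_hausdorff_dim
      packing_dim_le_upper_box_dim[OF paths_S_subset] upper_box_dim_le_packing_dim
    by (metis antisym)
qed

end
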